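(* Let $n\ge 2$, let $(R,J,a)$ be a Riesz triple on the unit sphere $S_n$ of $\mathbb{C}^n$, with $R=\{R_j\}_{j=1}^\infty$, $J=\{j_k\}_{k=1}^\infty$, $a=\{a_k\}_{k=1}^\infty$, and let $\Pi(R,J,a)$ be the corresponding Riesz product. Then \[ \dim_{\mathcal E}\Pi(R,J,a)\ \ge\ 2n-1-\alpha_0, \] where \[ \alpha_0=\max\left[0,\ \limsup_{k\to\infty}\left(\frac{\log\frac{|a_k|^2}{2}+\sum_{\ell=1}^{k-1}\log\left(1+\frac{|a_\ell|^2}{2}\right)}{\log j_k}\right)\right]. \] In particular, \[ \dim_{\mathcal E}\Pi(R,J,a)\ \ge\ 2n-1-\limsup_{k\to\infty}\left(\frac{1}{2\log j_k}\sum_{\ell=1}^{k-1}|a_\ell|^2\right). \]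
   Context: Let $n\ge 2$, $S=S_n=\{\zeta\in\mathbb{C}^n:|\zeta|=1\}$ with the Euclidean metric, and let $\sigma$ be the normalized Lebesgue (rotation-invariant probability) measure on $S$; $L^p(S)=L^p(\sigma)$. $H(j,0)$ is the space of (restrictions to $S$ of) homogeneous holomorphic polynomials of degree $j$ in $z_1,\dots,z_n$. A Ryll--Wojtaszczyk sequence with constant $\delta\in(0,1)$ is a sequence $\{R_j\}_{j=1}^\infty$ such that, for all $j=1,2,\dots$: $R_j\in H(j,0)$, $\|R_j\|_{L^\infty(S)}=1$, and $\|R_j\|_{L^2(S)}\ge\delta$. A Riesz triple $(R,J,a)$ consists of a Ryll--Wojtaszczyk sequence $R=\{R_j\}_{j=1}^\infty$ (with some constant $\delta\in(0,1)$), a sequence $J=\{j_k\}_{k=1}^\infty$ of positive integers with $j_{k+1}/j_k\ge 3$ for all $k$, and a sequence $a=\{a_k\}_{k=1}^\infty$ in the open unit disk $\mathbb{D}\subset\mathbb{C}$. The Riesz product \[ \Pi(R,J,a)=\prod_{k=1}^\infty\left(\frac{\overline{a}_k\overline{R}_{j_k}}{2}+1+\frac{a_kR_{j_k}}{2}\right) \] is the probability measure on $S$ that is the weak*-limit, as $N\to\infty$, of the measures $\prod_{k=1}^N\left(\frac{\overline{a}_k\overline{R}_{j_k}}{2}+1+\frac{a_kR_{j_k}}{2}\right)\sigma$ (this limit is known to exist). For a finite positive Borel measure $\mu$ on $S$ and $t>0$, the $t$-energy is $I_t(\mu)=\int_S\int_S\frac{d\mu(x)\,d\mu(y)}{|x-y|^t}$,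 and the energy dimension is $\dim_{\mathcal E}\mu=\sup\{t: I_t(\mu)<\infty\}$. Convention: $\log 0=-\infty$ (relevant when some $a_k=0$). *)

theory Defs
  imports "HOL-Probability.Probability"
begin

text \<open>
  $\mathbb{C}^n$ is the type \<open>complex ^ 'n\<close> with $n = $ \<open>CARD('n)\<close>; its \<open>norm\<close> and \<open>dist\<close> are the
  Euclidean ones, and $S$ is \<open>sphere 0 1\<close>. Functions on $S$ are total functions on
  \<open>complex ^ 'n\<close> whose values off $S$ are irrelevant; measures on $S$ live on the Borel
  \<open>\<sigma>\<close>-algebra of $S$.
\<close>

abbreviation sphere_borel :: "(complex ^ 'n) measure" where
  "sphere_borel \<equiv> restrict_space borel (sphere 0 1)"

text \<open>
  The normalized Lebesgue measure \<open>\<sigma>\<close> is the law of the direction \<open>sgn x = x /\<^sub>R norm x\<close> of a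
  uniformly distributed point \<open>x\<close> of the unit ball. The origin, a null set, is removed so that
  \<open>sgn\<close> maps into $S$.
\<close>

definition sphere_measure :: "(complex ^ 'n) measure" where
  "sphere_measure =
     distr (restrict_space (uniform_measure lborel (ball 0 1)) (- {0})) sphere_borel sgn"

lemma space_sphere_measure [simp]: "space sphere_measure = sphere 0 1"
  by (simp add: sphere_measure_def space_restrict_space)

lemma sets_sphere_measure [simp, measurable_cong]: "sets sphere_measure = sets sphere_borel"
  by (simp add: sphere_measure_def)

lemma prob_space_sphere_measure:
  "prob_space (sphere_measure :: (complex ^ 'n) measure)"
proof -
  let ?B = "ball 0 1 :: (complex ^ 'n) set"
  let ?U = "uniform_measure lborel ?B"
  interpret U: prob_space ?U
  proof (rule prob_space_uniform_measure)
    show "emeasure lborel ?B \<noteq> \<infinity>"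
      using emeasure_lborel_ball_finite[of "0 :: complex ^ 'n" 1] by auto
    have "0 < measure lborel ?B"
      using content_ball_pos[of 1 "0 :: complex ^ 'n"] by simp
    then show "emeasure lborel ?B \<noteq> 0"
      by (auto simp: measure_def)
  qed
  have "emeasure ?U {0} = 0"
    by (simp add: emeasure_uniform_measure Int_insert_right)
  then have "AE x in ?U. x \<in> - {0}"
    by (intro AE_I[of _ _ "{0}"]) auto
  then have "emeasure ?U (- {0}) = 1"
    by (intro U.emeasure_eq_1_AE) auto
  then have *: "prob_space (restrict_space ?U (- {0}))"
    by (intro prob_space_restrict_space) auto
  show ?thesis
    unfolding sphere_measure_def
  proof (rule prob_space.prob_space_distr[OF *], rule measurable_restrict_space2)
    show "sgn \<in> space (restrict_space ?U (- {0})) \<rightarrow> sphere 0 1"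
      by (auto simp: space_restrict_space norm_sgn)
    have "(\<lambda>x :: complex ^ 'n. x /\<^sub>R norm x) \<in> borel_measurable borel"
      by measurable
    then have "(sgn :: complex ^ 'n \<Rightarrow> _) \<in> borel_measurable borel"
      by (simp add: sgn_div_norm[abs_def])
    then have "(sgn :: complex ^ 'n \<Rightarrow> _) \<in> borel_measurable ?U"
      by simp
    then show "sgn \<in> borel_measurable (restrict_space ?U (- {0}))"
      by (rule measurable_restrict_space1)
  qed
qed

text \<open>Restrictions to $S$ of homogeneous holomorphic polynomials of degree \<open>j\<close>; the sum runs over
  the multi-indices \<open>\<alpha>\<close> of total degree \<open>j\<close>.\<close>

definition hol_hom :: "nat \<Rightarrow> (complex ^ 'n \<Rightarrow> complex) set" where
  "hol_hom j = {f. \<exists>c :: ('n \<Rightarrow> nat) \<Rightarrow> complex. \<forall>z \<in> sphere 0 1.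
     f z = (\<Sum>\<alpha> | (\<Sum>i\<in>UNIV. \<alpha> i) = j. c \<alpha> * (\<Prod>i\<in>UNIV. (z $ i) ^ \<alpha> i))}"

lemma finite_multi_indices: "finite {\<alpha> :: 'n::finite \<Rightarrow> nat. (\<Sum>i\<in>UNIV. \<alpha> i) = j}"
proof (rule finite_subset)
  show "{\<alpha> :: 'n \<Rightarrow> nat. (\<Sum>i\<in>UNIV. \<alpha> i) = j} \<subseteq> PiE UNIV (\<lambda>_. {..j})"
    by (auto intro: member_le_sum)
qed (auto intro: finite_PiE)

text \<open>All sequences below are indexed from 1; their values at 0 are irrelevant.\<close>

definition ryll_wojtaszczyk :: "real \<Rightarrow> (nat \<Rightarrow> complex ^ 'n \<Rightarrow> complex) \<Rightarrow> bool" where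
  "ryll_wojtaszczyk \<delta> R \<longleftrightarrow> 0 < \<delta> \<and> \<delta> < 1 \<and>
     (\<forall>j\<ge>1. R j \<in> hol_hom j \<and>
            esssup sphere_measure (\<lambda>z. ereal (cmod (R j z))) = 1 \<and>
            sqrt (LINT z|sphere_measure. (cmod (R j z))\<^sup>2) \<ge> \<delta>)"

definition riesz_triple ::
    "(nat \<Rightarrow> complex ^ 'n \<Rightarrow> complex) \<Rightarrow> (nat \<Rightarrow> nat) \<Rightarrow> (nat \<Rightarrow> complex) \<Rightarrow> bool" where
  "riesz_triple R J a \<longleftrightarrow>
     (\<exists>\<delta>. ryll_wojtaszczyk \<delta> R) \<and>
     (\<forall>k\<ge>1. J k > 0) \<and> (\<forall>k\<ge>1. real (J (Suc k)) / real (J k) \<ge> 3) \<and>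
     (\<forall>k\<ge>1. cmod (a k) < 1)"

definition riesz_partial_product ::
    "(nat \<Rightarrow> complex ^ 'n \<Rightarrow> complex) \<Rightarrow> (nat \<Rightarrow> nat) \<Rightarrow> (nat \<Rightarrow> complex) \<Rightarrow> nat \<Rightarrow>
     complex ^ 'n \<Rightarrow> complex" where
  "riesz_partial_product R J a N z =
     (\<Prod>k=1..N. cnj (a k) * cnj (R (J k) z) / 2 + 1 + a k * R (J k) z / 2)"

text \<open>\<open>\<mu>\<close> is the Riesz product $\Pi(R,J,a)$: the probability measure on $S$ that is the weak*-limit
  (against $C(S)$) of the partial products times \<open>\<sigma>\<close>.\<close>

definition is_riesz_product ::
    "(nat \<Rightarrow> complex ^ 'n \<Rightarrow> complex) \<Rightarrow> (nat \<Rightarrow> nat) \<Rightarrow> (nat \<Rightarrow> complex) \<Rightarrow>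
     (complex ^ 'n) measure \<Rightarrow> bool" where
  "is_riesz_product R J a \<mu> \<longleftrightarrow>
     prob_space \<mu> \<and> sets \<mu> = sets sphere_borel \<and>
     (\<forall>f :: complex ^ 'n \<Rightarrow> complex. continuous_on (sphere 0 1) f \<longrightarrow>
        (\<lambda>N. LINT z|sphere_measure. f z * riesz_partial_product R J a N z)
          \<longlonglongrightarrow> (LINT z|\<mu>. f z))"

text \<open>The kernel is \<open>ennreal\<close>-valued so that it is \<open>\<infinity>\<close> on the diagonal.\<close>

definition energy :: "real \<Rightarrow> 'a::metric_space measure \<Rightarrow> ennreal" where
  "energy t \<mu> = (\<integral>\<^sup>+x. \<integral>\<^sup>+y. 1 / ennreal (dist x y powr t) \<partial>\<mu> \<partial>\<mu>)"

lemma energy_kernel_diagonal: "1 / ennreal (dist x x powr t) = \<infinity>"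
  by simp

definition energy_dim :: "'a::metric_space measure \<Rightarrow> ereal" where
  "energy_dim \<mu> = Sup (ereal ` {t. 0 < t \<and> energy t \<mu> < \<infinity>})"

text \<open>Logarithm with the convention $\log 0 = -\infty$.\<close>

definition elog :: "real \<Rightarrow> ereal" where
  "elog x = (if x = 0 then - \<infinity> else ereal (ln x))"

definition riesz_alpha0 :: "(nat \<Rightarrow> nat) \<Rightarrow> (nat \<Rightarrow> complex) \<Rightarrow> ereal" where
  "riesz_alpha0 J a = max 0 (limsup (\<lambda>k.
     (elog ((cmod (a k))\<^sup>2 / 2) + ereal (\<Sum>l\<in>{1..<k}. ln (1 + (cmod (a l))\<^sup>2 / 2)))
       / ereal (ln (real (J k)))))"

end

theory Submission
  imports Defs
begin

text \<open>
  For unit vectors, \<open>dist x y\<^sup>2 = 2 - 2 Re h\<close> with \<open>h = \<langle>x, y\<rangle>\<close>, so the Riesz kernel \<open>dist x y powr - t\<close> is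
  a power series in \<open>Re h\<close> with positive coefficients, that is, a positive combination of the kernels
  \<open>h ^ p * cnj h ^ q\<close>. Such a kernel only sees the parts of the partial products on which the
  circle \<open>z \<mapsto> cis \<theta> *s z\<close> acts by the characters \<open>p - q\<close> and \<open>q - p\<close>. By lacunarity of \<open>J\<close>, each
  character occurs for at most one word in the factors, whose sup norm is bounded by the product of the
  \<open>cmod (a k) / 2\<close> involved. Together with the bound \<open>O((p + q + 1) powr - (n - 1))\<close> for the integral
  of \<open>cmod h ^ (p + q)\<close> over one variable, summation over \<open>p - q = m\<close> gives \<open>O((\<bar>m\<bar> + 1) powr (t - (2n - 1)))\<close>
  per unit of squared mass at the character \<open>m\<close>. The factor \<open>k\<close> contributes characters of size comparable
  to \<open>J k\<close> with total squared mass \<open>cmod (a k)\<^sup>2 / 2 * (\<Prod>l<k. 1 + cmod (a l)\<^sup>2 / 2)\<close>, which is at most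
  \<open>J k powr \<alpha>\<close> eventually for every \<open>\<alpha> > \<alpha>\<^sub>0\<close>; so the energy is dominated by a geometric series when
  \<open>t + \<alpha> < 2n - 1\<close>.
\<close>

section \<open>Gamma quotients and the coefficients of the Riesz kernel\<close>

text \<open>The exponent \<open>2n - 1\<close> has a heuristic source. At total degree j = p + q the
  kernel coefficient is of order j^(t/2 - 1) times a symmetric binomial probability, about j^(-1/2)
  exp(-m^2 / (2j)) for m = p - q. So only j of order at least m^2 matter, and with the moment factor
  j^(-(n-1)) the sum of j^(t/2 - 1/2 - n) over these j has order m^(t - (2n-1)), converging exactly
  for t < 2n - 1. Gauss' series replaces Gaussian asymptotics by an exact evaluation. The obstacle
  is that the Riesz kernel is unbounded, whereas the weak* limit is tested only on continuous
  functions of one variable. The kernel is therefore damped by a factor r < 1 and cut off at degree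
  L, which leaves a finite sum of products u(x) v(y). This shapes all later estimates: they must be
  uniform in the number N of factors, in r and in L.\<close>

lemma negative_binomial_sums:
  fixes b v :: real
  assumes "\<bar>v\<bar> < 1"
  shows "(\<lambda>q. pochhammer b q / fact q * v ^ q) sums (1 - v) powr (- b)"
proof -
  have "(\<lambda>n. ((-b) gchoose n) * (-v)^n) sums (1 + (-v)) powr (-b)"
    by (rule gen_binomial_real) (use assms in auto)
  moreover have "((-b) gchoose n) * (-v)^n = pochhammer b n / fact n * v ^ n" for n
    by (simp add: gbinomial_pochhammer power_minus[of v])

  ultimately show ?thesis by simp
qed

text \<open>The inequality half of Gauss' evaluation of the hypergeometric series at 1: integrate the
  binomial series of \<open>(1 - v) powr - b\<close> against a Beta density.\<close>

lemma hypergeometric_partial_sum_le: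
  fixes a b c :: real
  assumes a: "a > 0" and b: "b > 0" and c: "c > a + b"
  shows "(\<Sum>q<L. Gamma (a + real q) * Gamma (b + real q) / (Gamma (c + real q) * fact q))
           \<le> Gamma a * Gamma b * Gamma (c - a - b) / (Gamma (c - a) * Gamma (c - b))"
proof -
  let ?w = "\<lambda>q. pochhammer b q / fact q"
  have *: "((\<lambda>v. \<Sum>q<L. ?w q * (v powr (a + real q - 1) * (1 - v) powr (c - a - 1)))
          has_integral (\<Sum>q<L. ?w q * Beta (a + real q) (c - a))) {0..1}"
    using a b c by (intro has_integral_sum has_integral_mult_right has_integral_Beta_real) auto
  have le: "(\<Sum>q<L. ?w q * Beta (a + real q) (c - a)) \<le> Beta a (c - a - b)"
  proof (rule has_integral_le[OF *])
    show "((\<lambda>v. v powr (a - 1) * (1 - v) powr (c - a - b - 1)) has_integral Beta a (c - a - b)) {0..1}"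
      using a b c by (intro has_integral_Beta_real) auto
    fix v :: real assume v: "v \<in> {0..1}"
    show "(\<Sum>q<L. ?w q * (v powr (a + real q - 1) * (1 - v) powr (c - a - 1)))
            \<le> v powr (a - 1) * (1 - v) powr (c - a - b - 1)"
    proof (cases "v = 0 \<or> v = 1")
      \<comment> \<open>At the endpoints \<open>0 powr _\<close> is 0 by convention, so both sides
        vanish whatever the signs of the exponents.\<close>
      case True then show ?thesis by auto
    next
      case False
      with v have v: "0 < v" "v < 1" by auto
      have "(\<Sum>q<L. ?w q * v ^ q) \<le> (1 - v) powr (- b)"
      proof (rule sum_le_suminf[OF sums_summable, THEN order_trans])
        show "(\<lambda>q. ?w q * v ^ q) sums (1 - v) powr (- b)"
          by (rule negative_binomial_sums) (use v in auto)
        then show "suminf (\<lambda>q. ?w q * v ^ q) \<le> (1 - v) powr (- b)"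
          by (simp add: sums_iff)
      qed (use v b in \<open>auto intro!: mult_nonneg_nonneg divide_nonneg_nonneg pochhammer_nonneg\<close>)
      then have "(v powr (a - 1) * (1 - v) powr (c - a - 1)) * (\<Sum>q<L. ?w q * v ^ q)
          \<le> (v powr (a - 1) * (1 - v) powr (c - a - 1)) * (1 - v) powr (- b)"
        by (intro mult_left_mono) auto
      also have "\<dots> = v powr (a - 1) * (1 - v) powr (c - a - b - 1)"
        by (simp add: mult.assoc flip: powr_add) (simp add: algebra_simps)
      also have "(v powr (a - 1) * (1 - v) powr (c - a - 1)) * (\<Sum>q<L. ?w q * v ^ q)
        = (\<Sum>q<L. ?w q * (v powr (a + real q - 1) * (1 - v) powr (c - a - 1)))"
        unfolding sum_distrib_left
      proof (intro sum.cong refl)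
        fix q
        have "v powr (a + real q - 1) = v powr (a - 1) * v ^ q"
          using v by (simp add: powr_realpow[symmetric] flip: powr_add) (simp add: algebra_simps)
        then show "v powr (a - 1) * (1 - v) powr (c - a - 1) * (?w q * v ^ q)
          = ?w q * (v powr (a + real q - 1) * (1 - v) powr (c - a - 1))" by simp
      qed
      finally show ?thesis .
    qed
  qed
  have pos: "Gamma b > 0" "Gamma (c - a) > 0" using a b c by auto
  have "(\<Sum>q<L. Gamma (a + real q) * Gamma (b + real q) / (Gamma (c + real q) * fact q))
      = (\<Sum>q<L. ?w q * Beta (a + real q) (c - a)) * (Gamma b / Gamma (c - a))"
    unfolding sum_distrib_right
  proof (intro sum.cong refl)
    fix q
    have "pochhammer b q = Gamma (b + q) / Gamma b"
      using b by (intro pochhammer_Gamma) (auto dest: nonpos_Ints_nonpos)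
    moreover have "a + real q + (c - a) = c + real q" by simp
    ultimately show "Gamma (a + real q) * Gamma (b + real q) / (Gamma (c + real q) * fact q)
      = ?w q * Beta (a + real q) (c - a) * (Gamma b / Gamma (c - a))"
      using pos by (simp only: Beta_def) (simp add: field_simps)
  qed
  also have "\<dots> \<le> Beta a (c - a - b) * (Gamma b / Gamma (c - a))"
    using pos by (intro mult_right_mono le) auto
  also have "\<dots> = Gamma a * Gamma b * Gamma (c - a - b) / (Gamma (c - a) * Gamma (c - b))"
    by (simp add: Beta_def algebra_simps)
  finally show ?thesis .
qed

lemma Gamma_real_plus1: "x > 0 \<Longrightarrow> Gamma (x + 1) = x * Gamma (x :: real)"
  by (rule Gamma_plus1) (auto dest: nonpos_Ints_nonpos)

text \<open>For exponents at most 1, \<open>y + 1\<close> is a convex combination of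
  \<open>y + s\<close> and \<open>y + s + 1\<close>, and log-convexity gives
  \<open>y * Gamma y \<le> Gamma (y + s) * (y + s) powr (1 - s)\<close>; replacing
  \<open>y + s\<close> by \<open>2 * y\<close> costs at most the factor 2. Larger exponents follow
  from the functional equation.\<close>

lemma Gamma_powr_le:
  fixes y \<tau> :: real
  assumes y: "y \<ge> 1" and \<tau>: "\<tau> > 0"
  shows "Gamma y * y powr \<tau> \<le> 2 * Gamma (y + \<tau>)"
proof -
  have base: "Gamma y * y powr s \<le> 2 * Gamma (y + s)" if s: "0 < s" "s \<le> 1" for s
  proof -
    have "ln (Gamma ((1 - (1 - s)) *\<^sub>R (y + s) + (1 - s) *\<^sub>R (y + s + 1)))
        \<le> (1 - (1 - s)) * ln (Gamma (y + s)) + (1 - s) * ln (Gamma (y + s + 1))"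
      using convex_onD[OF log_convex_Gamma_real, of "1 - s" "y + s" "y + s + 1"] s y
      by (simp add: o_def)
    moreover have "(1 - (1 - s)) *\<^sub>R (y + s) + (1 - s) *\<^sub>R (y + s + 1) = y + 1"
      by (simp add: algebra_simps)
    ultimately have "ln (Gamma (y + 1)) \<le> s * ln (Gamma (y + s)) + (1 - s) * ln (Gamma (y + s + 1))"
      by (metis add_diff_cancel_left' diff_add_cancel diff_diff_eq2 add.commute)
    moreover have "Gamma (y + s + 1) = (y + s) * Gamma (y + s)"
      using y s by (intro Gamma_real_plus1) auto
    moreover have "Gamma (y + 1) = y * Gamma y" using y by (intro Gamma_real_plus1) auto
    moreover have pos: "Gamma (y + s) > 0" "Gamma y > 0" using y s by auto
    ultimately have "ln (y * Gamma y) \<le> s * ln (Gamma (y + s)) + (1 - s) * ln ((y + s) * Gamma (y + s))"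
      by simp
    then have "ln y + ln (Gamma y) \<le> s * ln (Gamma (y + s)) + (1 - s) * (ln (y + s) + ln (Gamma (y + s)))"
      using y s pos by (simp add: ln_mult_pos)
    then have 1: "ln y + ln (Gamma y) \<le> ln (Gamma (y + s)) + (1 - s) * ln (y + s)"
      by (simp add: algebra_simps)
    have "ln (y + s) \<le> ln (2 * y)" using y s by (subst ln_le_cancel_iff) auto
    also have "\<dots> = ln 2 + ln y" using y by (simp add: ln_mult)
    finally have "(1 - s) * ln (y + s) \<le> (1 - s) * (ln 2 + ln y)" using s by (intro mult_left_mono) auto
    also have "\<dots> \<le> ln 2 + (1 - s) * ln y" using s by (simp add: algebra_simps)
    finally have "ln (Gamma y) + s * ln y \<le> ln 2 + ln (Gamma (y + s))"
      using 1 by (simp add: algebra_simps)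
    then have "exp (ln (Gamma y) + s * ln y) \<le> exp (ln 2 + ln (Gamma (y + s)))" by simp
    then show ?thesis using pos y by (simp add: exp_add powr_def)
  qed
  \<comment> \<open>Each unit step multiplies the right side by \<open>y + (s - 1)\<close>, which is
    at least \<open>y\<close>, so the constant 2 does not compound.\<close>
  have "Gamma y * y powr s \<le> 2 * Gamma (y + s)" if "0 < s" "s \<le> real k + 1" for s k
    using that
  proof (induction k arbitrary: s)
    case 0 then show ?case using base by auto
  next
    case (Suc k)
    show ?case
    proof (cases "s \<le> 1")
      case True then show ?thesis using base Suc by auto
    next
      case False
      have "Gamma y * y powr (s - 1) \<le> 2 * Gamma (y + (s - 1))"
        using Suc False by (intro Suc.IH) auto
      then have "y * (Gamma y * y powr (s - 1)) \<le> (y + (s - 1)) * (2 * Gamma (y + (s - 1)))"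
        using y False by (intro mult_mono[of y "y + (s - 1)"]) auto
      also have "\<dots> = 2 * Gamma (y + (s - 1) + 1)"
        using y False by (subst Gamma_real_plus1) auto
      also have "y * (Gamma y * y powr (s - 1)) = Gamma y * y powr s"
        using y by (simp add: powr_diff)
      finally show ?thesis by simp
    qed
  qed
  from this[of \<tau> "nat \<lceil>\<tau>\<rceil>"] \<tau> show ?thesis by linarith
qed

lemma Gamma_legendre_duplication_real:
  fixes y :: real
  assumes "y > 0"
  shows "Gamma y * Gamma (y + 1 / 2) = 2 powr (1 - 2 * y) * sqrt pi * Gamma (2 * y)"
proof -
  have "complex_of_real y \<notin> \<int>\<^sub>\<le>\<^sub>0" "complex_of_real y + 1 / 2 \<notin> \<int>\<^sub>\<le>\<^sub>0"
    using assms by (auto elim!: nonpos_Ints_cases simp: complex_eq_iff)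
  from Gamma_legendre_duplication[OF this]
  have "complex_of_real (Gamma y * Gamma (y + 1 / 2))
      = complex_of_real (2 powr (1 - 2 * y) * sqrt pi * Gamma (2 * y))"
    using Gamma_complex_of_real[of y] Gamma_complex_of_real[of "y + 1/2"] Gamma_complex_of_real[of "2 * y"]
    by (simp add: powr_def exp_of_real[symmetric])
  then show ?thesis by (simp only: of_real_eq_iff)
qed

text \<open>The coefficient of \<open>h ^ p * cnj h ^ q\<close> in the expansion of \<open>(1 - Re h) powr (- t / 2)\<close>.\<close>

definition riesz_kernel_coeff :: "real \<Rightarrow> nat \<Rightarrow> nat \<Rightarrow> real" where
  "riesz_kernel_coeff t p q = pochhammer (t / 2) (p + q) / (fact p * fact q * 2 ^ (p + q))"

lemma riesz_kernel_coeff_nonneg: "t > 0 \<Longrightarrow> riesz_kernel_coeff t p q \<ge> 0"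
  by (simp add: riesz_kernel_coeff_def pochhammer_nonneg)

lemma riesz_kernel_coeff_commute: "riesz_kernel_coeff t p q = riesz_kernel_coeff t q p"
  by (simp add: riesz_kernel_coeff_def ac_simps)

lemma pochhammer_le_power:
  fixes z :: real
  assumes "z \<ge> 0" shows "pochhammer z k \<le> (z + real k) ^ k"
proof -
  have "pochhammer z k = (\<Prod>i<k. z + of_nat i)"
    by (simp add: pochhammer_prod atLeast0LessThan)
  also have "\<dots> \<le> (\<Prod>i<k. z + real k)"
    using assms by (intro prod_mono) auto
  finally show ?thesis by simp
qed

text \<open>By Legendre duplication the left-hand side is a quotient with three Gamma factors above and
  three below; absorbing the power into one of them leaves the summand of a Gauss series in \<open>q\<close>.\<close>

lemma riesz_kernel_coeff_le_Gamma:
  fixes t :: real and n :: nat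
  assumes t: "0 < t" "t < 2 * real n - 1" and m: "m \<ge> 2 * n"
  defines "a \<equiv> real m / 2 + t / 4 - (real n - 1)" and "b \<equiv> real m / 2 + t / 4 + 1 / 2"
  shows "riesz_kernel_coeff t (m + q) q / (real (m + 2 * q) + 1) ^ (n - 1)
     \<le> real n ^ (n - 1) * 2 powr (t / 2 - 1) / (sqrt pi * Gamma (t / 2)) *
        (Gamma (a + real q) * Gamma (b + real q) / (Gamma (real m + 1 + real q) * fact q))"
proof -
  \<comment> \<open>Half of the argument \<open>t / 2 + (m + 2 * q)\<close> that the Pochhammer
    symbol produces, so that duplication splits it into Gamma values at \<open>y\<close> and
    \<open>y + 1/2\<close>.\<close>
  define y where "y = t / 4 + real m / 2 + real q"
  have n: "n \<ge> 1" using t by (cases n) auto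
  have m': "real m / 2 \<ge> real n" using m by linarith
  have y: "y > 0" using t by (simp add: y_def add_nonneg_pos add_pos_nonneg)
  have yn: "y - (real n - 1) > 0" using m' t by (simp add: y_def)
  have aq: "a + real q = y - (real n - 1)" "b + real q = y + 1/2"
    by (simp_all add: a_def b_def y_def)
  have "pochhammer (t / 2) (m + 2 * q) = Gamma (t / 2 + real (m + 2 * q)) / Gamma (t / 2)"
    using t by (intro pochhammer_Gamma) (auto dest: nonpos_Ints_nonpos)
  also have "t / 2 + real (m + 2 * q) = 2 * y" by (simp add: y_def)
  also have "Gamma (2 * y) = Gamma y * Gamma (y + 1/2) * 2 powr (2 * y - 1) / sqrt pi"
    using Gamma_legendre_duplication_real[OF y]
    by (simp add: field_simps powr_diff powr_minus)
  also have "2 powr (2 * y - 1) = 2 powr (t / 2 - 1) * 2 ^ (m + 2 * q)"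
    by (simp add: y_def flip: powr_add powr_realpow) (simp add: algebra_simps)
  finally have poch: "pochhammer (t / 2) (m + 2 * q) =
     Gamma y * Gamma (y + 1/2) * (2 powr (t / 2 - 1) * 2 ^ (m + 2 * q)) / sqrt pi / Gamma (t / 2)" .
  have "m + q + q = m + 2 * q" by simp
  then have coeff: "riesz_kernel_coeff t (m + q) q = Gamma y *
      (Gamma (y + 1/2) * 2 powr (t / 2 - 1) / (sqrt pi * Gamma (t / 2) * (fact (m + q) * fact q)))"
    by (simp only: riesz_kernel_coeff_def poch) (simp add: field_simps)
  have "Gamma y = pochhammer (y - (real n - 1)) (n - 1) * Gamma (y - (real n - 1))"
  proof -
    have "pochhammer (y - (real n - 1)) (n - 1)
        = Gamma (y - (real n - 1) + real (n - 1)) / Gamma (y - (real n - 1))"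
      using yn by (intro pochhammer_Gamma) (auto dest: nonpos_Ints_nonpos)
    moreover have "y - (real n - 1) + real (n - 1) = y" using n by (simp add: of_nat_diff)
    moreover have "Gamma (y - (real n - 1)) > 0" using yn by (rule Gamma_real_pos)
    ultimately show ?thesis by simp
  qed
  also have "pochhammer (y - (real n - 1)) (n - 1) \<le> (y - (real n - 1) + real (n - 1)) ^ (n - 1)"
    using yn by (intro pochhammer_le_power) auto
  also have "y - (real n - 1) + real (n - 1) = y" using n by (simp add: of_nat_diff)
  also have "y ^ (n - 1) \<le> (real n * (real (m + 2 * q) + 1)) ^ (n - 1)"
  proof (rule power_mono)
    have "t / 4 \<le> real n" "real (m + 2 * q) / 2 \<le> 1 * real (m + 2 * q)" using t by linarith+
    then have "t / 4 + real (m + 2 * q) / 2 \<le> real n + 1 * real (m + 2 * q)" by (rule add_mono)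
    also have "\<dots> \<le> real n + real n * real (m + 2 * q)" using n by (intro add_left_mono mult_right_mono) auto
    finally show "y \<le> real n * (real (m + 2 * q) + 1)" by (simp add: y_def algebra_simps add_divide_distrib)
  qed (use y in auto)
  finally have Gy: "Gamma y \<le> real n ^ (n - 1) * (real (m + 2 * q) + 1) ^ (n - 1) * Gamma (y - (real n - 1))"
    using yn by (simp add: power_mult_distrib)
  have f: "fact (m + q) = Gamma (real m + 1 + real q)"
    by (simp add: Gamma_fact[of "m + q", symmetric] add_ac)
  have "riesz_kernel_coeff t (m + q) q \<le>
     (real n ^ (n - 1) * (real (m + 2 * q) + 1) ^ (n - 1) * Gamma (y - (real n - 1))) *
      (Gamma (y + 1/2) * 2 powr (t / 2 - 1) / (sqrt pi * Gamma (t / 2) * (fact (m + q) * fact q)))"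
    unfolding coeff using t y by (intro mult_right_mono Gy) (auto intro!: divide_nonneg_nonneg mult_nonneg_nonneg)
  then have "riesz_kernel_coeff t (m + q) q / (real (m + 2 * q) + 1) ^ (n - 1) \<le>
     (real n ^ (n - 1) * (real (m + 2 * q) + 1) ^ (n - 1) * Gamma (y - (real n - 1))) *
      (Gamma (y + 1/2) * 2 powr (t / 2 - 1) / (sqrt pi * Gamma (t / 2) * (fact (m + q) * fact q)))
      / (real (m + 2 * q) + 1) ^ (n - 1)"
    by (intro divide_right_mono) auto
  also have "\<dots> = real n ^ (n - 1) * 2 powr (t / 2 - 1) / (sqrt pi * Gamma (t / 2)) *
        (Gamma (y - (real n - 1)) * Gamma (y + 1/2) / (fact (m + q) * fact q))"
  proof -
    have "(real (m + 2 * q) + 1) ^ (n - 1) \<noteq> 0" by (simp add: add_nonneg_pos)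
    then show ?thesis by (simp add: field_simps)
  qed
  finally show ?thesis unfolding aq f .
qed

text \<open>The Gamma bound requires \<open>m\<close> to be large compared with \<open>n\<close>.
  Small \<open>m\<close> are reached by raising \<open>m\<close> one unit at a time, at the price of
  a constant independent of \<open>m\<close> and \<open>q\<close>: \<open>4 * real n / t\<close>
  bounds the coefficient ratio, and \<open>2 ^ (n - 1)\<close> covers the change of the
  denominator.\<close>

lemma riesz_kernel_coeff_shift:
  fixes t :: real and n :: nat
  assumes t: "0 < t" "t < 2 * real n - 1"
  shows "riesz_kernel_coeff t (m + q) q / (real (m + 2 * q) + 1) ^ (n - 1)
     \<le> (4 * real n / t * 2 ^ (n - 1)) * (riesz_kernel_coeff t (m + 1 + q) q / (real (m + 1 + 2 * q) + 1) ^ (n - 1))"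
proof -
  define j where "j = m + 2 * q"
  have j: "(m + q) + q = j" "Suc (m + q) + q = Suc j" "m + 1 + q + q = Suc j" "m + 1 + q = Suc (m + q)" "m + 1 + 2 * q = Suc j" by (simp_all add: j_def)
  have tj: "t / 2 + real j > 0" using t by (simp add: add_pos_nonneg)
  define c where "c = riesz_kernel_coeff t (m + q) q"
  have c0: "c \<ge> 0" using t by (simp add: c_def riesz_kernel_coeff_nonneg)
  have 1: "riesz_kernel_coeff t (m + 1 + q) q = c * ((t / 2 + real j) / (2 * (real (m + q) + 1)))"
    unfolding c_def riesz_kernel_coeff_def j pochhammer_rec' fact_Suc power_Suc
    by (simp add: field_simps del: of_nat_add)
  have "1 \<le> (4 * real n / t) * ((t / 2 + real j) / (2 * (real (m + q) + 1)))"
  proof -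
    have "real (m + q) + 1 \<le> real j + 1" by (simp add: j_def)
    then have "t * (2 * (real (m + q) + 1)) \<le> t * (2 * (real j + 1))" using t by (intro mult_left_mono) auto
    also have "\<dots> = 2 * t + 2 * t * real j" by (simp add: algebra_simps)
    also have "\<dots> \<le> 2 * real n * t + 4 * real n * real j"
      using t by (intro add_mono mult_right_mono) auto
    also have "\<dots> = (4 * real n) * (t / 2 + real j)" by (simp add: algebra_simps)
    finally have "1 \<le> ((4 * real n) * (t / 2 + real j)) / (t * (2 * (real (m + q) + 1)))"
      using t by (subst le_divide_eq_1_pos) (auto intro!: mult_pos_pos add_nonneg_pos)
    then show ?thesis by simp
  qed
  then have 2: "c * 1 \<le> c * ((4 * real n / t) * ((t / 2 + real j) / (2 * (real (m + q) + 1))))"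
    by (rule mult_left_mono[OF _ c0])
  have 3: "1 / (real j + 1) ^ (n - 1) \<le> 2 ^ (n - 1) * (1 / (real (Suc j) + 1) ^ (n - 1))"
  proof -
    have "(real (Suc j) + 1) ^ (n - 1) \<le> (2 * (real j + 1)) ^ (n - 1)" by (intro power_mono) auto
    then have "(real (Suc j) + 1) ^ (n - 1) \<le> 2 ^ (n - 1) * (real j + 1) ^ (n - 1)"
      by (simp only: power_mult_distrib)
    moreover have "(real (Suc j) + 1) ^ (n - 1) > 0" "(real j + 1) ^ (n - 1) > 0" by simp_all
    ultimately show ?thesis by (simp only: divide_simps) (simp add: mult_ac)
  qed
  have "c * (1 / (real j + 1) ^ (n - 1)) \<le>
     (c * ((4 * real n / t) * ((t / 2 + real j) / (2 * (real (m + q) + 1))))) * (2 ^ (n - 1) * (1 / (real (Suc j) + 1) ^ (n - 1)))"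
    using 2 3 c0 t tj by (intro mult_mono) auto
  then show ?thesis unfolding j 1[unfolded j] unfolding c_def[symmetric] j_def[symmetric]
    by (simp add: field_simps)
qed

text \<open>In the Gauss series the excess \<open>c - a - b\<close> equals \<open>\<tau>\<close>,
  which does not depend on \<open>m\<close> and is positive because \<open>t < 2n - 1\<close>. What
  depends on \<open>m\<close> are the two quotients of Gamma values at arguments differing by
  \<open>\<tau>\<close>; each is of order \<open>m powr (- \<tau>)\<close>, and
  \<open>2 * \<tau>\<close> is the exponent claimed.\<close>

lemma riesz_kernel_coeff_sum_le:
  fixes t :: real and n :: nat
  assumes t: "0 < t" "t < 2 * real n - 1"
  obtains C where "C > 0"
    "\<And>m L. (\<Sum>q<L. riesz_kernel_coeff t (m + q) q / (real (m + 2 * q) + 1) ^ (n - 1))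
             \<le> C * (real m + 1) powr (t - (2 * real n - 1))"
proof -
  define \<tau> where "\<tau> = (2 * real n - 1 - t) / 2"
  define T where "T m q = riesz_kernel_coeff t (m + q) q / (real (m + 2 * q) + 1) ^ (n - 1)" for m q
  define K where "K = real n ^ (n - 1) * 2 powr (t / 2 - 1) / (sqrt pi * Gamma (t / 2))"
  define D where "D = 4 * real n / t * 2 ^ (n - 1)"
  have n: "n \<ge> 1" using t by (cases n) auto
  have \<tau>: "\<tau> > 0" using t by (simp add: \<tau>_def field_simps)
  have K: "K > 0" using t n by (auto simp: K_def intro!: divide_pos_pos mult_pos_pos)
  have D: "D > 0" using t n by (simp add: D_def)
  have shift: "T m q \<le> D ^ k * T (m + k) q" for m q k
  proof (induction k)
    case (Suc k)
    have "T (m + k) q \<le> D * T (m + k + 1) q"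
      unfolding T_def D_def by (rule riesz_kernel_coeff_shift[OF t])
    then have "D ^ k * T (m + k) q \<le> D ^ k * (D * T (m + k + 1) q)" using D by (intro mult_left_mono) auto
    with Suc show ?case by (simp add: mult_ac)
  qed auto
  \<comment> \<open>The shift by \<open>4 * n\<close> compensates the \<open>real n - 1\<close>
    subtracted in \<open>a\<close>, so that \<open>a\<close> and \<open>b\<close> are at least 1 and
    at least \<open>(m + 1) / 2\<close> for every \<open>m\<close>.\<close>
  have main: "(\<Sum>q<L. T (m + 4 * n) q) \<le> K * (4 * Gamma \<tau> * 4 powr \<tau>) * (real m + 1) powr (t - (2 * real n - 1))" for m L
  proof -
    let ?M = "m + 4 * n"
    define a where "a = real ?M / 2 + t / 4 - (real n - 1)"
    define b where "b = real ?M / 2 + t / 4 + 1 / 2"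
    define c where "c = real ?M + 1"
    have a: "a \<ge> (real m + 1) / 2" "a \<ge> 1" using t n by (simp_all add: a_def field_simps)
    have b: "b \<ge> (real m + 1) / 2" "b \<ge> 1" using t n by (simp_all add: b_def field_simps)
    have cab: "c - a = b + \<tau>" "c - b = a + \<tau>" "c - a - b = \<tau>"
      by (simp_all add: a_def b_def c_def \<tau>_def field_simps)
    have half: "(g / g') \<le> 2 * ((real m + 1) / 2) powr (- \<tau>)"
      if "g = Gamma y" "g' = Gamma (y + \<tau>)" "y \<ge> (real m + 1) / 2" "y \<ge> 1" for g g' y
    proof -
      have pos: "Gamma (y + \<tau>) > 0" using that \<tau> by auto
      have "Gamma y * ((real m + 1) / 2) powr \<tau> \<le> Gamma y * y powr \<tau>"
        using that \<tau> by (intro mult_left_mono powr_mono2) auto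
      also have "\<dots> \<le> 2 * Gamma (y + \<tau>)" using that \<tau> by (intro Gamma_powr_le) auto
      finally show ?thesis using pos that by (simp add: powr_minus field_simps)
    qed
    have "(\<Sum>q<L. T ?M q) \<le> (\<Sum>q<L. K * (Gamma (a + real q) * Gamma (b + real q) / (Gamma (c + real q) * fact q)))"
      unfolding T_def K_def a_def b_def c_def
      by (intro sum_mono riesz_kernel_coeff_le_Gamma[OF t]) auto
    also have "\<dots> = K * (\<Sum>q<L. (Gamma (a + real q) * Gamma (b + real q) / (Gamma (c + real q) * fact q)))"
      by (simp add: sum_distrib_left)
    also have "\<dots> \<le> K * (Gamma a * Gamma b * Gamma (c - a - b) / (Gamma (c - a) * Gamma (c - b)))"
      using K a b cab \<tau> by (intro mult_left_mono hypergeometric_partial_sum_le) auto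
    also have "Gamma a * Gamma b * Gamma (c - a - b) / (Gamma (c - a) * Gamma (c - b))
       = Gamma \<tau> * ((Gamma a / Gamma (a + \<tau>)) * (Gamma b / Gamma (b + \<tau>)))"
      unfolding cab by (simp add: mult_ac)
    also have "\<dots> \<le> Gamma \<tau> * ((2 * ((real m + 1) / 2) powr (- \<tau>)) * (2 * ((real m + 1) / 2) powr (- \<tau>)))"
      using a b \<tau> by (intro mult_left_mono mult_mono half[OF refl refl]) (auto intro!: divide_nonneg_nonneg)
    also have "\<dots> = 4 * Gamma \<tau> * 4 powr \<tau> * (real m + 1) powr (t - (2 * real n - 1))"
    proof -
      have "((real m + 1) / 2) powr (- \<tau>) * ((real m + 1) / 2) powr (- \<tau>) = (((real m + 1) / 2)\<^sup>2) powr (- \<tau>)"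
        by (subst powr_mult[symmetric]) (auto simp: power2_eq_square)
      also have "\<dots> = ((real m + 1)\<^sup>2 / 4) powr (-\<tau>)" by (simp add: power_divide)
      also have "\<dots> = 4 powr \<tau> * ((real m + 1)\<^sup>2) powr (-\<tau>)"
        by (subst powr_divide) (auto simp: powr_minus field_simps)
      also have "((real m + 1)\<^sup>2) powr (-\<tau>) = (real m + 1) powr (2 * (- \<tau>))"
        by (subst powr_powr[symmetric]) (simp add: powr_numeral)
      also have "2 * (-\<tau>) = t - (2 * real n - 1)" by (simp add: \<tau>_def field_simps)
      finally show ?thesis by (simp add: mult_ac)
    qed
    finally show ?thesis using K by (simp add: mult.assoc)
  qed
  show ?thesis
  proof (rule that)
    show "D ^ (4 * n) * (K * (4 * Gamma \<tau> * 4 powr \<tau>)) > 0" using D K \<tau> by auto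
    fix m L
    have "(\<Sum>q<L. T m q) \<le> (\<Sum>q<L. D ^ (4 * n) * T (m + 4 * n) q)"
      by (intro sum_mono shift)
    also have "\<dots> = D ^ (4 * n) * (\<Sum>q<L. T (m + 4 * n) q)" by (simp add: sum_distrib_left)
    also have "\<dots> \<le> D ^ (4 * n) * (K * (4 * Gamma \<tau> * 4 powr \<tau>) * (real m + 1) powr (t - (2 * real n - 1)))"
      using D by (intro mult_left_mono main) auto
    finally show "(\<Sum>q<L. riesz_kernel_coeff t (m + q) q / (real (m + 2 * q) + 1) ^ (n - 1))
       \<le> D ^ (4 * n) * (K * (4 * Gamma \<tau> * 4 powr \<tau>)) * (real m + 1) powr (t - (2 * real n - 1))"
      by (simp add: T_def mult.assoc)
  qed
qed

section \<open>The measure on the sphere\<close>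

text \<open>The double counting behind uniqueness of Haar measure needs exactly translations
  (\<open>c = 1\<close>) and point reflections (\<open>c = -1\<close>).\<close>

lemma nn_integral_lborel_reflect_translate:
  fixes h :: "'a::euclidean_space \<Rightarrow> ennreal"
  assumes [measurable]: "h \<in> borel_measurable borel" and "\<bar>c\<bar> = 1"
  shows "(\<integral>\<^sup>+x. h (t + c *\<^sub>R x) \<partial>lborel) = (\<integral>\<^sup>+x. h x \<partial>lborel)"
proof -
  have "lborel = density (distr lborel borel (\<lambda>x. t + c *\<^sub>R x)) (\<lambda>_. \<bar>c\<bar> ^ DIM('a))"
    by (rule lborel_affine) (use assms in auto)
  then have *: "lborel = distr lborel borel (\<lambda>x::'a. t + c *\<^sub>R x)"
    using assms by (simp add: density_1)
  have "(\<integral>\<^sup>+x. h x \<partial>distr lborel borel (\<lambda>x::'a. t + c *\<^sub>R x)) = (\<integral>\<^sup>+x. h (t + c *\<^sub>R x) \<partial>lborel)"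
    by (rule nn_integral_distr) auto
  with * show ?thesis by metis
qed

text \<open>Uniqueness of Haar measure: integrating \<open>indicator A (f x) * indicator B (f x + y)\<close> in both
  orders yields \<open>\<nu> A * \<lambda> B = \<lambda> A * \<nu> B\<close> for Lebesgue measure \<open>\<lambda>\<close> and its image \<open>\<nu>\<close>; take for \<open>B\<close>
  the unit ball.\<close>

lemma distr_lborel_linear_isometry:
  fixes f :: "'a::euclidean_space \<Rightarrow> 'a"
  assumes lin: "linear f" and iso: "\<And>x. norm (f x) = norm x"
  shows "distr lborel borel f = lborel"
proof (rule measure_eqI)
  fix A assume "A \<in> sets (distr lborel borel f)"
  then have A[measurable]: "A \<in> sets borel" by simp
  define B where "B = (ball 0 1 :: 'a set)"
  have B[measurable]: "B \<in> sets borel" by (simp add: B_def)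
  have [measurable]: "f \<in> borel_measurable borel"
    using linear_continuous_on[OF linear_conv_bounded_linear[THEN iffD1, OF lin]]
    by (rule borel_measurable_continuous_onI)
  have inj: "inj f"
    unfolding linear_injective_0[OF lin] using iso by (metis norm_eq_zero)
  then have surj: "surj f" using linear_injective_imp_surjective[OF lin] by auto
  define g where "g = inv f"
  have g: "f (g y) = y" for y using surj by (simp add: g_def surj_f_inv_f)
  have nu: "emeasure (distr lborel borel f) E = (\<integral>\<^sup>+x. indicator E (f x) \<partial>lborel)" if [measurable]: "E \<in> sets borel" for E
  proof -
    have "f -` E \<in> sets borel" using measurable_sets[of f borel borel E] by simp
    moreover have "indicator E (f x) = (indicator (f -` E) x :: ennreal)" for x
      by (simp add: indicator_def)
    ultimately show ?thesis by (simp add: emeasure_distr)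
  qed
  have "(\<integral>\<^sup>+y. \<integral>\<^sup>+x. indicator A (f x) * indicator B (f x + y) \<partial>lborel \<partial>lborel)
      = (\<integral>\<^sup>+x. \<integral>\<^sup>+y. indicator A (f x) * indicator B (f x + y) \<partial>lborel \<partial>(lborel::'a measure))"
    by (rule lborel_pair.Fubini') measurable
  also have "\<dots> = (\<integral>\<^sup>+x. indicator A (f x) * emeasure lborel B \<partial>lborel)"
  proof (rule nn_integral_cong)
    fix x
    have "(\<integral>\<^sup>+y. indicator B (f x + 1 *\<^sub>R y) \<partial>lborel) = (\<integral>\<^sup>+y. indicator B y \<partial>lborel)"
      by (rule nn_integral_lborel_reflect_translate) auto
    then show "(\<integral>\<^sup>+y. indicator A (f x) * indicator B (f x + y) \<partial>lborel) = indicator A (f x) * emeasure lborel B"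
      by (simp add: nn_integral_cmult)
  qed
  also have "\<dots> = emeasure (distr lborel borel f) A * emeasure lborel B"
    by (simp add: nn_integral_multc nu)
  finally have 1: "(\<integral>\<^sup>+y. \<integral>\<^sup>+x. indicator A (f x) * indicator B (f x + y) \<partial>lborel \<partial>lborel)
      = emeasure (distr lborel borel f) A * emeasure lborel B" .
  have "(\<integral>\<^sup>+y. \<integral>\<^sup>+x. indicator A (f x) * indicator B (f x + y) \<partial>lborel \<partial>lborel)
      = (\<integral>\<^sup>+y. \<integral>\<^sup>+x. indicator A (f x - y) * indicator B (f x) \<partial>lborel \<partial>(lborel::'a measure))"
  proof (rule nn_integral_cong)
    \<comment> \<open>Translating \<open>x\<close> by \<open>- g y\<close> moves the shift by
      \<open>y\<close> from the second indicator to the first, because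
      \<open>f (g y) = y\<close>.\<close>
    fix y
    have "(\<integral>\<^sup>+x. indicator A (f (- g y + 1 *\<^sub>R x)) * indicator B (f (- g y + 1 *\<^sub>R x) + y) \<partial>lborel)
       = (\<integral>\<^sup>+x. indicator A (f x) * indicator B (f x + y) \<partial>lborel)"
      by (rule nn_integral_lborel_reflect_translate) auto
    moreover have "f (- g y + 1 *\<^sub>R x) = f x - y" for x
      using lin by (simp add: linear_diff g)
    ultimately show "(\<integral>\<^sup>+x. indicator A (f x) * indicator B (f x + y) \<partial>lborel)
      = (\<integral>\<^sup>+x. indicator A (f x - y) * indicator B (f x) \<partial>lborel)" by simp
  qed
  also have "\<dots> = (\<integral>\<^sup>+x. \<integral>\<^sup>+y. indicator A (f x - y) * indicator B (f x) \<partial>lborel \<partial>(lborel::'a measure))"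
    by (rule lborel_pair.Fubini') measurable
  also have "\<dots> = (\<integral>\<^sup>+x. emeasure lborel A * indicator B (f x) \<partial>lborel)"
  proof (rule nn_integral_cong)
    fix x
    have "(\<integral>\<^sup>+y. indicator A (f x + (-1) *\<^sub>R y) \<partial>lborel) = (\<integral>\<^sup>+y. indicator A y \<partial>lborel)"
      by (rule nn_integral_lborel_reflect_translate) auto
    then show "(\<integral>\<^sup>+y. indicator A (f x - y) * indicator B (f x) \<partial>lborel) = emeasure lborel A * indicator B (f x)"
      by (simp add: nn_integral_multc)
  qed
  also have "\<dots> = emeasure lborel A * emeasure (distr lborel borel f) B"
    by (simp add: nn_integral_cmult nu)
  also have "emeasure (distr lborel borel f) B = emeasure lborel B"
    by (subst emeasure_distr) (auto simp: B_def iso vimage_def ball_def)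
  finally have 2: "emeasure (distr lborel borel f) A * emeasure lborel B = emeasure lborel A * emeasure lborel B"
    using 1 by simp
  have "emeasure lborel B \<noteq> \<infinity>" "emeasure lborel B \<noteq> 0"
    using emeasure_lborel_ball_finite[of "0 :: 'a" 1] content_ball_pos[of 1 "0 :: 'a"]
    by (auto simp: B_def measure_def)
  with 2 show "emeasure (distr lborel borel f) A = emeasure lborel A"
    by (metis infinity_ennreal_def mult_divide_eq_ennreal)
qed simp

text \<open>The right side is the relative volume of the cone over \<open>A\<close> in the unit
  ball. In this form both rotation invariance and cap estimates become statements about Lebesgue
  measure.\<close>

lemma emeasure_sphere_measure:
  fixes A :: "(complex ^ 'n) set"
  assumes "A \<in> sets sphere_borel"
  shows "emeasure sphere_measure A =
    emeasure lborel {x \<in> ball 0 1 - {0}. sgn x \<in> A} / emeasure lborel (ball 0 1 :: (complex ^ 'n) set)"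
proof -
  let ?B = "ball 0 1 :: (complex ^ 'n) set"
  let ?U = "uniform_measure lborel ?B"
  have A: "A \<in> sets borel" "A \<subseteq> sphere 0 1"
    using assms by (auto simp: sets_restrict_space)
  have "(\<lambda>x :: complex ^ 'n. x /\<^sub>R norm x) \<in> borel_measurable borel"
    by measurable
  then have sgn[measurable]: "(sgn :: complex ^ 'n \<Rightarrow> _) \<in> borel_measurable borel"
    by (simp add: sgn_div_norm[abs_def])
  have "sgn \<in> restrict_space ?U (- {0}) \<rightarrow>\<^sub>M sphere_borel"
  proof (rule measurable_restrict_space2)
    show "sgn \<in> space (restrict_space ?U (- {0})) \<rightarrow> sphere 0 1"
      by (auto simp: space_restrict_space norm_sgn)
    have "(sgn :: complex ^ 'n \<Rightarrow> _) \<in> borel_measurable ?U" by simp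
    then show "sgn \<in> borel_measurable (restrict_space ?U (- {0}))"
      by (rule measurable_restrict_space1)
  qed
  then have "emeasure sphere_measure A = emeasure (restrict_space ?U (- {0})) (sgn -` A \<inter> - {0})"
    unfolding sphere_measure_def using assms
    by (subst emeasure_distr) (auto simp: space_restrict_space)
  also have "\<dots> = emeasure ?U (sgn -` A \<inter> - {0})"
    by (rule emeasure_restrict_space) auto
  also have "\<dots> = emeasure lborel (?B \<inter> (sgn -` A \<inter> - {0})) / emeasure lborel ?B"
    using A by (intro emeasure_uniform_measure) auto
  also have "?B \<inter> (sgn -` A \<inter> - {0}) = {x \<in> ball 0 1 - {0}. sgn x \<in> A}" by auto
  finally show ?thesis .
qed

text \<open>A linear isometry commutes with \<open>sgn\<close>, so it carries cones over sets to
  cones over their images, and Lebesgue measure is invariant under it.\<close>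

lemma distr_sphere_measure_linear_isometry:
  fixes f :: "complex ^ 'n \<Rightarrow> complex ^ 'n"
  assumes lin: "linear f" and iso: "\<And>x. norm (f x) = norm x"
  shows "distr sphere_measure sphere_borel f = sphere_measure"
proof (rule measure_eqI)
  fix A assume "A \<in> sets (distr sphere_measure sphere_borel f)"
  then have A: "A \<in> sets sphere_borel" by simp
  then have A': "A \<in> sets borel" "A \<subseteq> sphere 0 1" by (auto simp: sets_restrict_space)
  have [measurable]: "f \<in> borel_measurable borel"
    using linear_continuous_on[OF linear_conv_bounded_linear[THEN iffD1, OF lin]]
    by (rule borel_measurable_continuous_onI)
  have "(\<lambda>x :: complex ^ 'n. x /\<^sub>R norm x) \<in> borel_measurable borel"
    by measurable
  then have sgn[measurable]: "(sgn :: complex ^ 'n \<Rightarrow> _) \<in> borel_measurable borel"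
    by (simp add: sgn_div_norm[abs_def])
  have f: "f \<in> sphere_borel \<rightarrow>\<^sub>M sphere_borel"
    using iso by (intro measurable_restrict_space3) auto
  then have fA: "f -` A \<inter> sphere 0 1 \<in> sets sphere_borel"
    using A measurable_sets[OF f A] by (simp add: space_restrict_space)
  have "emeasure (distr sphere_measure sphere_borel f) A = emeasure sphere_measure (f -` A \<inter> sphere 0 1)"
    using A f by (subst emeasure_distr) (simp_all add: measurable_cong_sets[OF sets_sphere_measure refl])
  also have "\<dots> = emeasure lborel {x \<in> ball 0 1 - {0}. sgn x \<in> f -` A \<inter> sphere 0 1} / emeasure lborel (ball 0 1 :: (complex ^ 'n) set)"
    by (rule emeasure_sphere_measure[OF fA])
  also have "{x \<in> ball 0 1 - {0}. sgn x \<in> f -` A \<inter> sphere 0 1} = f -` {x \<in> ball 0 1 - {0}. sgn x \<in> A}"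
  proof -
    have "f (sgn x) = sgn (f x)" for x
      using lin iso by (simp add: sgn_div_norm linear_scale)
    moreover have "f x = 0 \<longleftrightarrow> x = 0" for x using iso[of x] by (metis norm_eq_zero)
    ultimately show ?thesis using iso by (auto simp: norm_sgn)
  qed
  also have "emeasure lborel (f -` {x \<in> ball 0 1 - {0}. sgn x \<in> A})
     = emeasure (distr lborel borel f) {x \<in> ball 0 1 - {0}. sgn x \<in> A}"
  proof -
    have "(ball 0 1 - {0}) \<inter> sgn -` A \<in> sets (borel :: (complex ^ 'n) measure)"
      using A' measurable_sets[OF sgn A'(1)] by auto
    also have "(ball 0 1 - {0}) \<inter> sgn -` A = {x \<in> ball 0 1 - {0}. sgn x \<in> A}" by auto
    finally show ?thesis by (subst emeasure_distr) auto
  qed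
  also have "\<dots> = emeasure lborel {x \<in> ball 0 1 - {0}. sgn x \<in> A}"
    by (simp only: distr_lborel_linear_isometry[OF assms])
  also have "\<dots> / emeasure lborel (ball 0 1 :: (complex ^ 'n) set) = emeasure sphere_measure A"
    by (rule emeasure_sphere_measure[OF A, symmetric])
  finally show "emeasure (distr sphere_measure sphere_borel f) A = emeasure sphere_measure A" .
qed simp


section \<open>The Hermitian product, the circle action, and moments over caps\<close>

definition hinner :: "complex ^ 'n \<Rightarrow> complex ^ 'n \<Rightarrow> complex" where
  "hinner x y = (\<Sum>i\<in>UNIV. x $ i * cnj (y $ i))"

lemma Re_hinner: "Re (hinner x y) = x \<bullet> y"
  by (simp add: hinner_def inner_vec_def inner_complex_def)

lemma cnj_hinner: "cnj (hinner x y) = hinner y x"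
  by (simp add: hinner_def mult.commute)

lemma cmod_hinner_commute: "cmod (hinner x y) = cmod (hinner y x)"
  by (metis cnj_hinner complex_mod_cnj)

lemma hinner_scale_left: "hinner (c *s x) y = c * hinner x y"
  by (simp add: hinner_def sum_distrib_left mult.assoc)

lemma hinner_scale_right: "hinner x (c *s y) = cnj c * hinner x y"
  by (simp add: hinner_def sum_distrib_left mult_ac)

lemma norm_vector_scalar_mult: "norm (c *s (x :: complex ^ 'n)) = cmod c * norm x"
  by (simp add: norm_vec_def norm_mult L2_set_right_distrib)

text \<open>Rotating \<open>x\<close> by a unimodular scalar makes the product real and nonnegative;
  the real Cauchy-Schwarz inequality then applies.\<close>

lemma cmod_hinner_le: "cmod (hinner x y) \<le> norm x * norm y"
proof (cases "hinner x y = 0")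
  case False
  define c where "c = cnj (hinner x y) / cmod (hinner x y)"
  have c: "cmod c = 1" using False by (simp add: c_def norm_divide)
  have "c * hinner x y = cmod (hinner x y)"
    using False by (simp add: c_def complex_norm_square[symmetric] power2_eq_square mult.commute[of "cnj _"] del: of_real_power)
  then have "cmod (hinner x y) = (c *s x) \<bullet> y"
    by (simp add: hinner_scale_left flip: Re_hinner)
  also have "\<dots> \<le> norm (c *s x) * norm y" by (rule norm_cauchy_schwarz)
  finally show ?thesis by (simp add: norm_vector_scalar_mult c)
qed simp

lemma continuous_on_hinner [continuous_intros]:
  assumes "continuous_on A f" "continuous_on A g"
  shows "continuous_on A (\<lambda>z. hinner (f z) (g z))"
  unfolding hinner_def using assms by (intro continuous_intros)

lemma linear_vector_scalar_mult: "linear (\<lambda>z :: complex ^ 'n. c *s z)"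
  by (rule linearI) (simp_all add: vec_eq_iff algebra_simps)

lemma borel_measurable_sphere_continuous:
  assumes "continuous_on (sphere 0 1) f"
  shows "f \<in> borel_measurable (sphere_measure :: (complex ^ 'n) measure)"
  unfolding measurable_cong_sets[OF sets_sphere_measure refl]
  by (rule borel_measurable_continuous_on_restrict[OF assms])

lemma integral_sphere_measure_phase:
  fixes F :: "complex ^ 'n \<Rightarrow> complex"
  assumes "F \<in> borel_measurable sphere_measure" "cmod c = 1"
  shows "(LINT z|sphere_measure. F (c *s z)) = (LINT z|sphere_measure. F z)"
proof -
  let ?f = "\<lambda>z :: complex ^ 'n. c *s z"
  have lin: "linear ?f" by (rule linear_vector_scalar_mult)
  have iso: "norm (?f x) = norm x" for x by (simp add: norm_vector_scalar_mult assms)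
  have "?f \<in> borel_measurable borel"
    using linear_continuous_on[OF linear_conv_bounded_linear[THEN iffD1, OF lin]]
    by (rule borel_measurable_continuous_onI)
  then have f: "?f \<in> sphere_borel \<rightarrow>\<^sub>M sphere_borel"
    using iso by (intro measurable_restrict_space3) auto
  have "(LINT z|sphere_measure. F z) = (LINT z|distr sphere_measure sphere_borel ?f. F z)"
    by (simp only: distr_sphere_measure_linear_isometry[OF lin iso])
  also have "\<dots> = (LINT z|sphere_measure. F (c *s z))"
    using assms(1) f unfolding measurable_cong_sets[OF sets_sphere_measure refl]
    by (intro integral_distr) (simp_all add: measurable_cong_sets[OF sets_sphere_measure refl])
  finally show ?thesis ..
qed

text \<open>A single rotation by the angle \<open>pi / k\<close> multiplies the integrand by -1, so
  the integral equals its own negative; no averaging over the circle is required.\<close>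

lemma integral_sphere_measure_character:
  fixes F :: "complex ^ 'n \<Rightarrow> complex" and k :: int
  assumes "F \<in> borel_measurable sphere_measure" "k \<noteq> 0"
    and char: "\<And>\<theta> z. z \<in> sphere 0 1 \<Longrightarrow> F (cis \<theta> *s z) = cis (of_int k * \<theta>) * F z"
  shows "(LINT z|sphere_measure. F z) = 0"
proof -
  have "(LINT z|sphere_measure. F z) = (LINT z|sphere_measure. F (cis (pi / of_int k) *s z))"
    by (rule integral_sphere_measure_phase[OF assms(1), symmetric]) simp
  also have "\<dots> = (LINT z|sphere_measure. - F z)"
  proof (intro Bochner_Integration.integral_cong refl)
    fix z :: "complex ^ 'n" assume "z \<in> space sphere_measure"
    then have "F (cis (pi / of_int k) *s z) = cis (of_int k * (pi / of_int k)) * F z"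
      by (intro char) simp
    also have "of_int k * (pi / of_int k) = pi" using assms(2) by simp
    finally show "F (cis (pi / of_int k) *s z) = - F z" by simp
  qed
  finally show ?thesis by simp
qed

lemma sphere_cap_in_sets:
  fixes x :: "complex ^ 'n"
  shows "{y \<in> sphere 0 1. cmod (hinner x y) \<ge> r} \<in> sets sphere_borel"
proof -
  have "closed {y. cmod (hinner x y) \<ge> r}"
    by (intro closed_Collect_le continuous_intros)
  then have "sphere 0 1 \<inter> {y. cmod (hinner x y) \<ge> r} \<in> sets sphere_borel"
    unfolding sets_restrict_space by (intro imageI) simp
  also have "sphere 0 1 \<inter> {y. cmod (hinner x y) \<ge> r} = {y \<in> sphere 0 1. cmod (hinner x y) \<ge> r}"
    by auto
  finally show ?thesis .
qed

text \<open>The cone over the cap lies within distance of order \<open>sqrt u\<close> of the unit disc in the complex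
  line through \<open>x\<close>, which is covered by order \<open>1 / u\<close> balls centred at a grid of mesh \<open>sqrt u\<close>.\<close>

lemma emeasure_sphere_small_cap_le:
  fixes x :: "complex ^ 'n"
  assumes x: "x \<in> sphere 0 1" and u: "0 < u" "u \<le> 1"
  shows "emeasure sphere_measure {y \<in> sphere 0 1. cmod (hinner x y) \<ge> 1 - u}
    \<le> ennreal (25 * 9 ^ CARD('n) * u ^ (CARD('n) - 1))"
proof -
  let ?B = "ball 0 1 :: (complex ^ 'n) set"
  define V where "V = measure lborel ?B"
  have V: "V > 0" using content_ball_pos[of 1 "0 :: complex ^ 'n"] by (simp add: V_def)
  have EV: "emeasure lborel ?B = ennreal V"
    unfolding V_def by (rule emeasure_eq_ennreal_measure) (use emeasure_lborel_ball_finite[of "0 :: complex ^ 'n" 1] in auto)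
  have DIM: "DIM(complex ^ 'n) = 2 * CARD('n)" by simp
  define \<delta> where "\<delta> = sqrt u"
  have \<delta>: "\<delta> > 0" "\<delta> \<le> 1" "\<delta>\<^sup>2 = u" using u by (simp_all add: \<delta>_def)
  define N where "N = \<lceil>1 / \<delta>\<rceil>"
  define g where "g kl = Complex (\<delta> * of_int (fst kl)) (\<delta> * of_int (snd kl))" for kl :: "int \<times> int"
  define I where "I = {-N..N} \<times> {-N..N}"
  let ?cap = "{y \<in> sphere 0 1. cmod (hinner x y) \<ge> 1 - u}"
  have cap: "?cap \<in> sets sphere_borel" by (rule sphere_cap_in_sets)
  have sub: "{z \<in> ball 0 1 - {0}. sgn z \<in> ?cap} \<subseteq> (\<Union>kl\<in>I. ball (g kl *s x) (3 * \<delta>))"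
  proof
    fix z assume "z \<in> {z \<in> ball 0 1 - {0}. sgn z \<in> ?cap}"
    then have z: "norm z < 1" "z \<noteq> 0" "cmod (hinner x (sgn z)) \<ge> 1 - u" by auto
    define l where "l = hinner z x"
    have "sgn z = complex_of_real (inverse (norm z)) *s z"
      by (simp add: vec_eq_iff sgn_div_norm scaleR_conv_of_real[where 'a = complex])
    then have "cmod (hinner x (sgn z)) = inverse (norm z) * cmod l"
      by (simp add: hinner_scale_right norm_mult norm_inverse l_def cmod_hinner_commute)
    with z have lge: "cmod l \<ge> (1 - u) * norm z" by (simp add: field_simps)
    have lle: "cmod l < 1" using cmod_hinner_le[of z x] x z by (simp add: l_def)
    define kl where "kl = (\<lfloor>Re l / \<delta>\<rfloor>, \<lfloor>Im l / \<delta>\<rfloor>)"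
    have floor_in: "\<lfloor>s / \<delta>\<rfloor> \<in> {-N..N}" if "\<bar>s\<bar> < 1" for s
    proof -
      have "-1 \<le> s" "s \<le> 1" using that by auto
      then have "(-1) / \<delta> \<le> s / \<delta>" "s / \<delta> \<le> 1 / \<delta>"
        using \<delta>(1) divide_right_mono[of "-1" s \<delta>] divide_right_mono[of s 1 \<delta>] by auto
      moreover have "1 / \<delta> \<le> of_int N" unfolding N_def by (rule le_of_int_ceiling)
      ultimately have "- of_int N \<le> s / \<delta>" "s / \<delta> \<le> of_int N" by linarith+
      then show ?thesis by (auto simp: le_floor_iff) linarith
    qed
    have kl: "kl \<in> I"
      using floor_in[of "Re l"] floor_in[of "Im l"] lle abs_Re_le_cmod[of l] abs_Im_le_cmod[of l]
      by (auto simp: kl_def I_def)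
    have fl: "(s - \<delta> * of_int \<lfloor>s / \<delta>\<rfloor>)\<^sup>2 \<le> u" for s
    proof -
      have "s - \<delta> * of_int \<lfloor>s / \<delta>\<rfloor> = \<delta> * (s / \<delta> - of_int \<lfloor>s / \<delta>\<rfloor>)"
        using \<delta> by (simp add: field_simps)
      moreover have "s / \<delta> - of_int \<lfloor>s / \<delta>\<rfloor> \<ge> 0" "s / \<delta> - of_int \<lfloor>s / \<delta>\<rfloor> \<le> 1" by linarith+
      ultimately show ?thesis using u
        by (simp only: power_mult_distrib \<delta>) (intro mult_left_le; auto intro: power_le_one)
    qed
    \<comment> \<open>Both the rounding error in the disc and the distance to the complex line have
      square at most \<open>2 * u\<close>. As 2 is less than the square of 3/2, each is below
      \<open>3 / 2 * \<delta>\<close>, and together they stay below the radius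
      \<open>3 * \<delta>\<close>.\<close>
    have "(cmod (l - g kl))\<^sup>2 \<le> u + u"
      unfolding cmod_power2 using fl[of "Re l"] fl[of "Im l"] by (simp add: g_def kl_def)
    also have "\<dots> < (3 / 2 * \<delta>)\<^sup>2" using u by (simp add: power_mult_distrib \<delta> power_divide)
    finally have d1: "cmod (l - g kl) < 3 / 2 * \<delta>"
      by (rule power2_less_imp_less) (use \<delta> in simp)
    \<comment> \<open>Pythagoras: \<open>l *s x\<close> is the orthogonal projection of
      \<open>z\<close> onto the complex line through \<open>x\<close>.\<close>
    have "(norm (z - l *s x))\<^sup>2 = (norm z)\<^sup>2 - (cmod l)\<^sup>2"
    proof -
      have "z \<bullet> (l *s x) = (cmod l)\<^sup>2"
        unfolding l_def cmod_power2 by (simp add: hinner_scale_right power2_eq_square flip: Re_hinner)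
      moreover have "(norm (l *s x))\<^sup>2 = (cmod l)\<^sup>2" using x by (simp add: norm_vector_scalar_mult)
      ultimately show ?thesis
        by (simp add: power2_norm_eq_inner inner_diff_left inner_diff_right inner_commute)
    qed
    also have "\<dots> \<le> (norm z)\<^sup>2 - ((1 - u) * norm z)\<^sup>2"
      using lge u by (intro diff_left_mono power_mono) auto
    also have "\<dots> = (norm z)\<^sup>2 * (2 * u - u\<^sup>2)"  by (simp add: power2_eq_square algebra_simps)
    also have "\<dots> \<le> 1 * (2 * u)"
      using z u by (intro mult_mono) (auto simp: power2_eq_square abs_square_le_1 intro: mult_le_one)
    also have "\<dots> < (3 / 2 * \<delta>)\<^sup>2" using u by (simp add: power_mult_distrib \<delta> power_divide)
    finally have d2: "norm (z - l *s x) < 3 / 2 * \<delta>"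
      by (rule power2_less_imp_less) (use \<delta> in simp)
    have "norm ((l - g kl) *s x) = cmod (l - g kl)"
      by (subst norm_vector_scalar_mult) (use x in simp)
    then have "norm ((z - l *s x) + (l - g kl) *s x) < 3 * \<delta>"
      using d1 d2 norm_triangle_ineq[of "z - l *s x" "(l - g kl) *s x"] by linarith
    also have "(z - l *s x) + (l - g kl) *s x = z - g kl *s x"
      by (simp add: vec_eq_iff algebra_simps)
    finally have "z \<in> ball (g kl *s x) (3 * \<delta>)" by (simp add: dist_norm norm_minus_commute)
    then show "z \<in> (\<Union>kl\<in>I. ball (g kl *s x) (3 * \<delta>))" using kl by blast
  qed
  \<comment> \<open>The real dimension is \<open>2 * CARD('n)\<close>, so the radius contributes
    \<open>(9 * u) ^ CARD('n)\<close>. The at most \<open>25 / u\<close> grid points take away one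
    power of \<open>u\<close>.\<close>
  have ball: "emeasure lborel (ball c (3 * \<delta>) :: (complex ^ 'n) set) = ennreal (V * (9 ^ CARD('n) * u ^ CARD('n)))" for c
  proof -
    have "unit_ball_vol (real (DIM(complex ^ 'n))) = V"
      unfolding V_def by (subst content_ball) auto
    moreover have "(3 * \<delta>) ^ DIM(complex ^ 'n) = 9 ^ CARD('n) * u ^ CARD('n)"
      unfolding DIM power_mult by (simp add: power_mult_distrib \<delta>)
    ultimately show ?thesis using \<delta> by (subst emeasure_ball) auto
  qed
  have N: "N \<ge> 1" "of_int (2 * N + 1) \<le> 5 / \<delta>"
  proof -
    have "1 / \<delta> \<ge> 1" using \<delta> by simp
    moreover have "of_int N < 1 / \<delta> + 1" unfolding N_def by linarith
    ultimately show "of_int (2 * N + 1) \<le> 5 / \<delta>" by simp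
    show "N \<ge> 1" using \<open>1 / \<delta> \<ge> 1\<close> unfolding N_def by linarith
  qed
  have "card I = nat (2 * N + 1) * nat (2 * N + 1)" by (simp add: I_def card_cartesian_product)
  then have "real (card I) = of_int (2 * N + 1) * of_int (2 * N + 1)" using N by simp
  also have "\<dots> \<le> 5 / \<delta> * (5 / \<delta>)" using N \<delta>(1) by (intro mult_mono) auto
  also have "\<dots> = 25 / u" by (simp flip: \<delta>(3) add: power2_eq_square)
  finally have card: "real (card I) \<le> 25 / u" .
  have "emeasure lborel {z \<in> ball 0 1 - {0}. sgn z \<in> ?cap} \<le> emeasure lborel (\<Union>kl\<in>I. ball (g kl *s x) (3 * \<delta>))"
    by (rule emeasure_mono[OF sub]) auto
  also have "\<dots> \<le> (\<Sum>kl\<in>I. emeasure lborel (ball (g kl *s x) (3 * \<delta>)))"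
    by (rule emeasure_subadditive_finite) (auto simp: I_def)
  also have "\<dots> = ennreal (real (card I) * (V * (9 ^ CARD('n) * u ^ CARD('n))))"
    unfolding ball using V u by (simp add: ennreal_mult'' ennreal_of_nat_eq_real_of_nat)
  also have "\<dots> \<le> ennreal (25 / u * (V * (9 ^ CARD('n) * u ^ CARD('n))))"
    using card V u by (intro ennreal_leI mult_right_mono) auto
  also have "25 / u * (V * (9 ^ CARD('n) * u ^ CARD('n))) = V * (25 * 9 ^ CARD('n) * u ^ (CARD('n) - 1))"
    using u zero_less_card_finite[where 'a = 'n] by (simp add: power_eq_if[of u "CARD('n)"])
  finally have "emeasure lborel {z \<in> ball 0 1 - {0}. sgn z \<in> ?cap} \<le> ennreal (V * (25 * 9 ^ CARD('n) * u ^ (CARD('n) - 1)))" .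
  then have "emeasure sphere_measure ?cap \<le> ennreal (V * (25 * 9 ^ CARD('n) * u ^ (CARD('n) - 1))) / ennreal V"
    unfolding emeasure_sphere_measure[OF cap] EV by (rule divide_right_mono_ennreal)
  also have "\<dots> = ennreal (25 * 9 ^ CARD('n) * u ^ (CARD('n) - 1))"
    using V u by (subst divide_ennreal) auto
  finally show ?thesis .
qed

text \<open>For \<open>u > 1\<close> the right side exceeds the total mass 1. Allowing all positive
  \<open>u\<close> spares the moment estimate a case distinction in its sum over caps.\<close>

lemma emeasure_sphere_cap_le:
  fixes x :: "complex ^ 'n"
  assumes x: "x \<in> sphere 0 1" and u: "0 < u"
  shows "emeasure sphere_measure {y \<in> sphere 0 1. cmod (hinner x y) \<ge> 1 - u}
    \<le> ennreal (25 * 9 ^ CARD('n) * u ^ (CARD('n) - 1))"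
proof (cases "u \<le> 1")
  case False
  interpret prob_space "sphere_measure :: (complex ^ 'n) measure" by (rule prob_space_sphere_measure)
  have "1 * 1 * 1 \<le> 25 * 9 ^ CARD('n) * u ^ (CARD('n) - 1)"
    using False by (intro mult_mono one_le_power) auto
  then have "1 \<le> ennreal (25 * 9 ^ CARD('n) * u ^ (CARD('n) - 1))" by simp
  with emeasure_le_1 show ?thesis by (rule order_trans)
qed (use emeasure_sphere_small_cap_le[OF x u] in simp)

lemma power_div_fact_le_exp:
  fixes x :: real
  assumes "x \<ge> 0" shows "x ^ m / fact m \<le> exp x"
proof -
  have s: "(\<lambda>n. x ^ n / fact n) sums exp x" using exp_converges[of x] by (simp add: field_simps)
  have "(\<Sum>n\<in>{m}. x ^ n / fact n) \<le> (\<Sum>n. x ^ n / fact n)"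
    using assms by (intro sum_le_suminf sums_summable[OF s]) auto
  with s show ?thesis by (simp add: sums_iff)
qed

text \<open>With \<open>h\<close> the modulus of the product and
  \<open>v = (j + 1) * (1 - h)\<close>, the integrand is at most \<open>exp 1 * exp (- v)\<close>.
  The points with \<open>v < i + 1\<close> lie in a cap of measure of order
  \<open>((i + 1) / (j + 1)) ^ (n - 1)\<close>, and the exponential decay in \<open>i\<close> makes
  the sum over all \<open>i\<close> converge.\<close>

lemma hinner_moment_le:
  obtains C where "C > 0"
    "\<And>(x :: complex ^ 'n) j. x \<in> sphere 0 1 \<Longrightarrow>
       (LINT y|sphere_measure. cmod (hinner x y) ^ j) \<le> C / (real j + 1) ^ (CARD('n) - 1)"
proof -
  define k where "k = CARD('n) - 1"
  \<comment> \<open>The two factors \<open>exp 1\<close> pay for replacing \<open>j\<close> by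
    \<open>j + 1\<close> in the exponent and for rounding \<open>v\<close> down to \<open>i\<close>.
    The decay \<open>exp (- (i + 1))\<close> is weakened to the power \<open>k + 2\<close>, so that
    two powers remain after the cap measure has used up \<open>k\<close>.\<close>
  define w where "w i = exp 1 * (exp 1 * (fact (k + 2) / (real i + 1) ^ (k + 2)))" for i
  define D :: real where "D = 25 * 9 ^ CARD('n) * exp 1 * exp 1 * fact (k + 2)"
  have D: "D > 0" by (simp add: D_def)
  have w: "w i \<ge> 0" for i by (simp add: w_def)
  have sq: "summable (\<lambda>i. 1 / (real i + 1)\<^sup>2)"
    using inverse_power_summable[of 2, where 'a = real, THEN summable_Suc_iff[THEN iffD2]]
    by (simp add: field_simps)
  define Q where "Q = (\<Sum>i. 1 / (real i + 1)\<^sup>2)"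
  have Q: "Q > 0" unfolding Q_def by (rule suminf_pos[OF sq]) (simp add: add_nonneg_pos)
  have "(LINT y|sphere_measure. cmod (hinner x y) ^ j) \<le> (D * Q) / (real j + 1) ^ k"
    if x: "x \<in> sphere 0 1" for x :: "complex ^ 'n" and j
  proof -
    define cap where "cap i = {y \<in> sphere 0 1. cmod (hinner x y) \<ge> 1 - (real i + 1) / (real j + 1)}" for i :: nat
    have cap: "cap i \<in> sets sphere_measure" for i
      unfolding cap_def sets_sphere_measure by (rule sphere_cap_in_sets)
    have meas: "(\<lambda>y. cmod (hinner x y) ^ j) \<in> borel_measurable sphere_measure"
      by (intro borel_measurable_sphere_continuous continuous_intros)
    have pt: "ennreal (cmod (hinner x y) ^ j) \<le> (\<Sum>i. ennreal (w i) * indicator (cap i) y)"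
      if y: "y \<in> sphere 0 1" for y
    proof -
      define h where "h = cmod (hinner x y)"
      have h: "0 \<le> h" "h \<le> 1" using cmod_hinner_le[of x y] x y by (simp_all add: h_def)
      define v where "v = (real j + 1) * (1 - h)"
      have v: "v \<ge> 0" using h by (simp add: v_def)
      define i where "i = nat \<lfloor>v\<rfloor>"
      have i: "real i \<le> v" "v < real i + 1" using v by (simp_all add: i_def)
      have "h \<le> exp (- (1 - h))" using exp_ge_add_one_self[of "-(1 - h)"] by simp
      then have "h ^ j \<le> exp (- (1 - h)) ^ j" using h by (intro power_mono) auto
      also have "\<dots> = exp ((1 - h) + - v)" by (simp add: v_def algebra_simps flip: exp_of_nat_mult)
      also have "\<dots> \<le> exp (1 + (1 + - (real i + 1)))" using h i by simp
      also have "\<dots> = exp 1 * (exp 1 * (1 / exp (real i + 1)))" by (simp only: exp_add exp_minus inverse_eq_divide)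
      also have "\<dots> \<le> w i"
      proof -
        have "(real i + 1) ^ (k + 2) / fact (k + 2) \<le> exp (real i + 1)" by (intro power_div_fact_le_exp) auto
        then have "1 / exp (real i + 1) \<le> 1 / ((real i + 1) ^ (k + 2) / fact (k + 2))"
          by (intro divide_left_mono) (auto intro!: divide_pos_pos zero_less_power mult_pos_pos add_nonneg_pos)
        then show ?thesis unfolding w_def by (intro mult_left_mono) auto
      qed
      finally have hw: "h ^ j \<le> w i" .
      have "(1 - h) \<le> (real i + 1) / (real j + 1)" using i by (simp add: v_def field_simps)
      then have "y \<in> cap i" using y by (simp add: cap_def h_def)
      with hw have "ennreal (h ^ j) \<le> (\<Sum>i\<in>{i}. ennreal (w i) * indicator (cap i) y)" by (simp add: ennreal_leI)
      also have "\<dots> \<le> (\<Sum>i. ennreal (w i) * indicator (cap i) y)"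
        by (rule sum_le_suminf) auto
      finally show ?thesis by (simp add: h_def)
    qed
    have "(\<integral>\<^sup>+y. ennreal (cmod (hinner x y) ^ j) \<partial>sphere_measure) \<le> (\<integral>\<^sup>+y. (\<Sum>i. ennreal (w i) * indicator (cap i) y) \<partial>sphere_measure)"
      by (intro nn_integral_mono pt) simp
    also have "\<dots> = (\<Sum>i. ennreal (w i) * emeasure sphere_measure (cap i))"
      using cap by (subst nn_integral_suminf) (auto simp: nn_integral_cmult_indicator intro!: borel_measurable_times borel_measurable_indicator)
    also have "\<dots> \<le> (\<Sum>i. ennreal ((D / (real j + 1) ^ k) * (1 / (real i + 1)\<^sup>2)))"
    proof (rule suminf_le)
      fix i
      have "ennreal (w i) * emeasure sphere_measure (cap i)
         \<le> ennreal (w i) * ennreal (25 * 9 ^ CARD('n) * ((real i + 1) / (real j + 1)) ^ (CARD('n) - 1))"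
        unfolding cap_def using x by (intro mult_left_mono emeasure_sphere_cap_le) (auto intro!: divide_pos_pos add_nonneg_pos)
      also have "\<dots> = ennreal (w i * (25 * 9 ^ CARD('n) * ((real i + 1) / (real j + 1)) ^ k))"
        using w by (subst ennreal_mult) (auto simp: k_def)
      also have "w i * (25 * 9 ^ CARD('n) * ((real i + 1) / (real j + 1)) ^ k) = (D / (real j + 1) ^ k) * (1 / (real i + 1)\<^sup>2)"
      proof -
        have "real i + 1 > 0" "real j + 1 > 0" by simp_all
        then show ?thesis unfolding w_def D_def power_add power_divide by (simp add: field_simps)
      qed
      finally show "ennreal (w i) * emeasure sphere_measure (cap i) \<le> ennreal ((D / (real j + 1) ^ k) * (1 / (real i + 1)\<^sup>2))" .
    qed auto
    also have "\<dots> = ennreal (\<Sum>i. (D / (real j + 1) ^ k) * (1 / (real i + 1)\<^sup>2))"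
      using D sq by (intro suminf_ennreal2 summable_mult) auto
    also have "(\<Sum>i. (D / (real j + 1) ^ k) * (1 / (real i + 1)\<^sup>2)) = (D * Q) / (real j + 1) ^ k"
      using suminf_mult[OF sq, of "D / (real j + 1) ^ k"] by (simp add: Q_def)
    finally have "(\<integral>\<^sup>+y. ennreal (cmod (hinner x y) ^ j) \<partial>sphere_measure) \<le> ennreal ((D * Q) / (real j + 1) ^ k)" .
    then show ?thesis using D Q meas
      by (subst integral_eq_nn_integral) (auto intro!: enn2real_leI)
  qed
  then show ?thesis using D Q that[of "D * Q"] by (auto simp: k_def)
qed

section \<open>Energies as limits of finite-rank forms\<close>

lemma sphere_coordinates_measurable:
  fixes \<mu> :: "(complex ^ 'n) measure"
  assumes "sets \<mu> = sets sphere_borel"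
  shows "(\<lambda>p. fst p) \<in> borel_measurable (\<mu> \<Otimes>\<^sub>M \<mu>)" "(\<lambda>p. snd p) \<in> borel_measurable (\<mu> \<Otimes>\<^sub>M \<mu>)"
proof -
  have id: "(\<lambda>x. x) \<in> \<mu> \<rightarrow>\<^sub>M borel"
    unfolding measurable_cong_sets[OF assms refl] by (intro measurable_restrict_space1) auto
  show "(\<lambda>p. fst p) \<in> borel_measurable (\<mu> \<Otimes>\<^sub>M \<mu>)"
    using measurable_compose[OF measurable_fst id] .
  show "(\<lambda>p. snd p) \<in> borel_measurable (\<mu> \<Otimes>\<^sub>M \<mu>)"
    using measurable_compose[OF measurable_snd id] .
qed

lemma pochhammer_sums_powr:
  fixes s :: real
  assumes "0 < r" "r < 1" "\<bar>s\<bar> \<le> 1"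
  shows "(\<lambda>j. pochhammer (t / 2) j / fact j * (r * s) ^ j) sums (1 - r * s) powr (- t / 2)"
proof -
  have "\<bar>r * s\<bar> \<le> r * 1" unfolding abs_mult using assms by (intro mult_mono) auto
  then have "\<bar>r * s\<bar> < 1" using assms by linarith
  from negative_binomial_sums[OF this, of "t / 2"] show ?thesis by simp
qed

text \<open>The coefficients are nonnegative, so the value of the full series at
  \<open>s = 1\<close> dominates. Being uniform in \<open>L\<close> and \<open>s\<close>, the bound
  serves for dominated convergence at fixed \<open>r\<close>.\<close>

lemma pochhammer_sum_abs_le:
  fixes s :: real
  assumes "t > 0" "0 < r" "r < 1" "\<bar>s\<bar> \<le> 1"
  shows "\<bar>\<Sum>j<L. pochhammer (t / 2) j / fact j * (r * s) ^ j\<bar> \<le> (1 - r) powr (- t / 2)"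
proof -
  have p: "pochhammer (t / 2) j \<ge> 0" for j using assms by (intro pochhammer_nonneg) auto
  have "\<bar>\<Sum>j<L. pochhammer (t / 2) j / fact j * (r * s) ^ j\<bar> \<le> (\<Sum>j<L. \<bar>pochhammer (t / 2) j / fact j * (r * s) ^ j\<bar>)"
    by (rule sum_abs)
  also have "\<dots> \<le> (\<Sum>j<L. pochhammer (t / 2) j / fact j * (r * 1) ^ j)"
  proof (rule sum_mono)
    fix j
    have "\<bar>(r * s) ^ j\<bar> \<le> (r * 1) ^ j"
      unfolding power_abs abs_mult using assms by (intro power_mono mult_mono) auto
    then show "\<bar>pochhammer (t / 2) j / fact j * (r * s) ^ j\<bar> \<le> pochhammer (t / 2) j / fact j * (r * 1) ^ j"
      unfolding abs_mult using p[of j] by (intro mult_mono) auto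
  qed
  also have "\<dots> \<le> (\<Sum>j. pochhammer (t / 2) j / fact j * (r * 1) ^ j)"
    using assms p by (intro sum_le_suminf sums_summable[OF pochhammer_sums_powr]) auto
  also have "\<dots> = (1 - r) powr (- t / 2)"
    using pochhammer_sums_powr[of r 1 t] assms by (simp add: sums_iff)
  finally show ?thesis .
qed

text \<open>Off the diagonal the damped kernels converge to
  \<open>(1 - x \<bullet> y) powr (- t / 2)\<close>, which exceeds the Riesz kernel by the factor
  \<open>2 powr (t / 2)\<close>. On the diagonal they equal \<open>(i + 2) powr (t / 2)\<close> and
  tend to infinity. An inequality suffices, since it feeds Fatou's lemma.\<close>

lemma riesz_kernel_le_liminf:
  fixes x y :: "complex ^ 'n"
  assumes t: "t > 0" and x: "norm x = 1" and y: "norm y = 1"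
  shows "1 / ennreal (dist x y powr t) \<le>
    liminf (\<lambda>i. ennreal ((1 - (1 - 1 / (real i + 2)) * (x \<bullet> y)) powr (- t / 2)))"
proof (cases "x = y")
  case True
  have "x \<bullet> x = 1" using x by (simp add: dot_square_norm)
  have "filterlim (\<lambda>i. real i + 2) at_top sequentially"
    by (rule filterlim_at_top_mono[OF filterlim_real_sequentially]) auto
  then have "filterlim (\<lambda>i. exp (t / 2 * ln (real i + 2))) at_top sequentially"
    using t by (intro filterlim_compose[OF exp_at_top] filterlim_tendsto_pos_mult_at_top[OF tendsto_const]
        filterlim_compose[OF ln_at_top]) auto
  then have "filterlim (\<lambda>i. (real i + 2) powr (t / 2)) at_top sequentially"
    by (simp add: powr_def add_nonneg_eq_0_iff)
  then have "((\<lambda>i. ennreal ((real i + 2) powr (t / 2))) \<longlongrightarrow> top) sequentially"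
    by (simp add: ennreal_tendsto_top_eq_at_top)
  moreover have "(real i + 2) powr (t / 2) = (1 - (1 - 1 / (real i + 2)) * (x \<bullet> y)) powr (- t / 2)" for i
    using True \<open>x \<bullet> x = 1\<close> by (simp add: powr_minus powr_divide)
  ultimately have "liminf (\<lambda>i. ennreal ((1 - (1 - 1 / (real i + 2)) * (x \<bullet> y)) powr (- t / 2))) = top"
    by (simp add: lim_imp_Liminf)
  then show ?thesis by simp
next
  case False
  define s where "s = x \<bullet> y"
  have d2: "(dist x y)\<^sup>2 = 2 * (1 - s)"
    using x y by (simp add: dist_norm power2_norm_eq_inner inner_diff_left inner_diff_right inner_commute s_def)
      (simp add: dot_square_norm)
  have d: "dist x y > 0" using False by simp
  then have s: "1 - s > 0" using d2 by (metis zero_less_power zero_less_mult_pos zero_less_numeral)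
  have "(\<lambda>i. 1 / (real i + 2)) \<longlonglongrightarrow> 0"
    using LIMSEQ_ignore_initial_segment[OF lim_const_over_n[of "1 :: real"], of 2] by (simp add: add.commute)
  then have "(\<lambda>i. (1 - (1 - 1 / (real i + 2)) * s) powr (- t / 2)) \<longlonglongrightarrow> (1 - (1 - 0) * s) powr (- t / 2)"
    using s by (intro tendsto_intros) auto
  then have "liminf (\<lambda>i. ennreal ((1 - (1 - 1 / (real i + 2)) * s) powr (- t / 2))) = ennreal ((1 - s) powr (- t / 2))"
    by (intro lim_imp_Liminf tendsto_ennrealI) auto
  moreover have "1 / ennreal (dist x y powr t) = ennreal (1 / dist x y powr t)"
    using d by (simp add: divide_ennreal flip: ennreal_1)
  moreover have "1 / dist x y powr t \<le> (1 - s) powr (- t / 2)"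
  proof -
    have "dist x y powr t = (dist x y powr 2) powr (t / 2)" unfolding powr_powr by simp
    also have "\<dots> = (2 * (1 - s)) powr (t / 2)" using d d2 by (simp add: powr_numeral)
    also have "\<dots> \<ge> (1 - s) powr (t / 2)" using s t by (intro powr_mono2) auto
    finally have "1 / dist x y powr t \<le> 1 / (1 - s) powr (t / 2)" using s d by (intro divide_left_mono) auto
    then show ?thesis by (simp add: powr_minus field_simps)
  qed
  ultimately show ?thesis unfolding s_def by (simp add: ennreal_leI)
qed

text \<open>For fixed \<open>r < 1\<close> the damped kernel is bounded, so dominated convergence
  removes the cutoff \<open>L\<close>; Fatou's lemma then removes the damping. Finiteness of the
  energy is thus reduced to a uniform bound for polynomial kernels.\<close>

lemma energy_le_truncated:
  fixes \<mu> :: "(complex ^ 'n) measure"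
  assumes "prob_space \<mu>" and sets: "sets \<mu> = sets sphere_borel" and t: "t > 0"
    and H: "\<And>r L. 0 < r \<Longrightarrow> r < 1 \<Longrightarrow>
      (LINT x|\<mu>. LINT y|\<mu>. (\<Sum>j<L. pochhammer (t / 2) j / fact j * (r * (x \<bullet> y)) ^ j)) \<le> H"
  shows "energy t \<mu> \<le> ennreal H"
proof -
  interpret prob_space \<mu> by fact
  interpret P: pair_prob_space \<mu> \<mu> ..
  have space: "space \<mu> = sphere 0 1" using sets_eq_imp_space_eq[OF sets] by (simp add: space_restrict_space)
  let ?M = "\<mu> \<Otimes>\<^sub>M \<mu>"
  note [measurable] = sphere_coordinates_measurable[OF sets]
  define K where "K r p = (1 - r * (fst p \<bullet> snd p)) powr (- t / 2)" for r :: real and p :: "(complex ^ 'n) \<times> (complex ^ 'n)"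
  define k where "k r L p = (\<Sum>j<L. pochhammer (t / 2) j / fact j * (r * (fst p \<bullet> snd p)) ^ j)" for r :: real and L :: nat and p :: "(complex ^ 'n) \<times> (complex ^ 'n)"
  have k_meas[measurable]: "k r L \<in> borel_measurable ?M" for r L unfolding k_def by measurable
  have K_meas[measurable]: "K r \<in> borel_measurable ?M" for r unfolding K_def by measurable
  have inner: "\<bar>fst p \<bullet> snd p\<bar> \<le> 1" if "p \<in> space ?M" for p
    using Cauchy_Schwarz_ineq2[of "fst p" "snd p"] that by (auto simp: space_pair_measure space)
  have le: "(\<integral>\<^sup>+p. ennreal (K r p) \<partial>?M) \<le> ennreal H" if r: "0 < r" "r < 1" for r
  proof -
    have bd: "\<bar>k r L p\<bar> \<le> (1 - r) powr (- t / 2)" if "p \<in> space ?M" for L p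
      unfolding k_def using t r inner[OF that] by (rule pochhammer_sum_abs_le)
    have lim: "(\<lambda>L. k r L p) \<longlonglongrightarrow> K r p" if "p \<in> space ?M" for p
      using pochhammer_sums_powr[OF r inner[OF that]] by (simp add: sums_def k_def K_def)
    have int: "integrable ?M (k r L)" for L
    proof (rule P.integrable_const_bound)
      show "AE p in ?M. norm (k r L p) \<le> (1 - r) powr (- t / 2)"
        unfolding real_norm_def by (rule AE_I2) (rule bd)
    qed measurable
    have conv: "(\<lambda>L. integral\<^sup>L ?M (k r L)) \<longlonglongrightarrow> integral\<^sup>L ?M (K r)"
    proof (rule integral_dominated_convergence)
      show "AE p in ?M. norm (k r L p) \<le> (1 - r) powr (- t / 2)" for L
        unfolding real_norm_def by (rule AE_I2) (rule bd)
      show "AE p in ?M. (\<lambda>L. k r L p) \<longlonglongrightarrow> K r p"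
        by (rule AE_I2) (rule lim)
    qed auto
    have "integral\<^sup>L ?M (k r L) \<le> H" for L
      using H[OF r, of L] P.integral_fst'[OF int[of L]] by (simp add: k_def)
    then have 1: "integral\<^sup>L ?M (K r) \<le> H" by (intro LIMSEQ_le_const2[OF conv]) auto
    have intK: "integrable ?M (K r)"
    proof (rule P.integrable_const_bound[where B = "(1 - r) powr (- t / 2)"])
      show "AE p in ?M. norm (K r p) \<le> (1 - r) powr (- t / 2)"
      proof (rule AE_I2)
        fix p assume p: "p \<in> space ?M"
        show "norm (K r p) \<le> (1 - r) powr (- t / 2)"
          unfolding real_norm_def
          by (rule LIMSEQ_le_const2[OF tendsto_rabs[OF lim[OF p]]]) (use bd[OF p] in blast)
      qed
    qed measurable
    have "(\<integral>\<^sup>+p. ennreal (K r p) \<partial>?M) = ennreal (integral\<^sup>L ?M (K r))"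
      by (rule nn_integral_eq_integral[OF intK]) (simp add: K_def)
    also have "\<dots> \<le> ennreal H" using 1 by (rule ennreal_leI)
    finally show ?thesis .
  qed
  let ?r = "\<lambda>i. 1 - 1 / (real i + 2)"
  have "energy t \<mu> \<le> (\<integral>\<^sup>+x. \<integral>\<^sup>+y. liminf (\<lambda>i. ennreal (K (?r i) (x, y))) \<partial>\<mu> \<partial>\<mu>)"
    unfolding energy_def K_def fst_conv snd_conv
    by (intro nn_integral_mono riesz_kernel_le_liminf t) (auto simp: space)
  also have "\<dots> = (\<integral>\<^sup>+p. liminf (\<lambda>i. ennreal (K (?r i) p)) \<partial>?M)"
    by (rule nn_integral_fst) measurable
  also have "\<dots> \<le> liminf (\<lambda>i. \<integral>\<^sup>+p. ennreal (K (?r i) p) \<partial>?M)"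
    by (rule nn_integral_liminf) measurable
  also have "\<dots> \<le> ennreal H"
  proof (rule Liminf_le)
    show "\<forall>\<^sub>F i in sequentially. (\<integral>\<^sup>+p. ennreal (K (?r i) p) \<partial>?M) \<le> ennreal H"
    proof (intro always_eventually allI le)
      fix i :: nat
      show "0 < ?r i" "?r i < 1" by simp_all
    qed
  qed simp
  finally show ?thesis .
qed

text \<open>On such kernels a double integral splits into products of single integrals, so weak*
  convergence passes to them without any convergence of product measures. The inductive form lets
  closure, integrability, continuity and convergence be proved from the product case and
  additivity.\<close>

inductive finite_rank :: "(complex ^ 'n \<Rightarrow> complex ^ 'n \<Rightarrow> complex) \<Rightarrow> bool" where
  finite_rank_prod: "continuous_on UNIV u \<Longrightarrow> continuous_on UNIV v \<Longrightarrow> finite_rank (\<lambda>x y. u x * v y)"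
| finite_rank_add: "finite_rank K \<Longrightarrow> finite_rank K' \<Longrightarrow> finite_rank (\<lambda>x y. K x y + K' x y)"

lemma finite_rank_const: "finite_rank (\<lambda>_ _. c)"
  using finite_rank_prod[of "\<lambda>_. c" "\<lambda>_. 1"] by (simp add: continuous_on_const)

lemma finite_rank_mult:
  assumes "finite_rank K" "finite_rank K'"
  shows "finite_rank (\<lambda>x y. K x y * K' x y)"
  using assms(1)
proof induction
  case uv: (finite_rank_prod u v)
  from assms(2) show ?case
  proof induction
    case (finite_rank_prod u' v')
    have "finite_rank (\<lambda>x y. (u x * u' x) * (v y * v' y))"
      using uv finite_rank_prod by (intro finite_rank.finite_rank_prod continuous_intros)
    then show ?case by (simp add: mult_ac)
  next
    case (finite_rank_add K K')
    then have "finite_rank (\<lambda>x y. u x * v y * K x y + u x * v y * K' x y)"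
      by (intro finite_rank.finite_rank_add)
    then show ?case by (simp add: distrib_left)
  qed
next
  case (finite_rank_add K1 K2)
  then have "finite_rank (\<lambda>x y. K1 x y * K' x y + K2 x y * K' x y)"
    by (intro finite_rank.finite_rank_add)
  then show ?case by (simp add: distrib_right)
qed

lemma finite_rank_power: "finite_rank K \<Longrightarrow> finite_rank (\<lambda>x y. K x y ^ k)"
  by (induction k) (auto intro: finite_rank_const finite_rank_mult)

lemma finite_rank_sum:
  "(\<And>i. i \<in> I \<Longrightarrow> finite_rank (K i)) \<Longrightarrow> finite_rank (\<lambda>x y. \<Sum>i\<in>I. K i x y)"
  by (induction I rule: infinite_finite_induct) (auto intro: finite_rank_const finite_rank_add)

lemma finite_rank_hinner: "finite_rank hinner"
proof -
  have "finite_rank (\<lambda>x y :: complex ^ 'n. \<Sum>i\<in>UNIV. x $ i * cnj (y $ i))"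
    by (intro finite_rank_sum finite_rank_prod continuous_intros)
  then show ?thesis by (simp add: hinner_def[abs_def])
qed

lemma finite_rank_cnj_hinner: "finite_rank (\<lambda>x y. cnj (hinner x y))"
proof -
  have "finite_rank (\<lambda>x y :: complex ^ 'n. \<Sum>i\<in>UNIV. cnj (x $ i) * y $ i)"
    by (intro finite_rank_sum finite_rank_prod continuous_intros)
  then show ?thesis by (simp add: hinner_def[abs_def])
qed

lemma integrable_continuous_sphere:
  fixes f :: "complex ^ 'n \<Rightarrow> 'b::{banach, second_countable_topology}"
  assumes "finite_measure M" and sets: "sets M = sets sphere_borel" and f: "continuous_on (sphere 0 1) f"
  shows "integrable M f"
proof -
  interpret finite_measure M by fact
  have space: "space M = sphere 0 1" using sets_eq_imp_space_eq[OF sets] by (simp add: space_restrict_space)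
  have "compact (f ` sphere 0 1)" using f by (intro compact_continuous_image) auto
  then obtain B where B: "\<And>x. x \<in> sphere 0 1 \<Longrightarrow> norm (f x) \<le> B"
    using compact_imp_bounded bounded_iff by (metis imageI)
  show ?thesis
  proof (rule integrable_const_bound)
    show "AE x in M. norm (f x) \<le> B" using B by (intro AE_I2) (simp add: space)
    show "f \<in> borel_measurable M"
      unfolding measurable_cong_sets[OF sets refl] by (rule borel_measurable_continuous_on_restrict[OF f])
  qed
qed

text \<open>Bilinear in \<open>P\<close>, without conjugation: \<open>P\<close> is the density of a
  possibly complex measure with respect to \<open>M\<close>. Partial products over the sphere
  measure and the constant 1 over the limit measure are the two uses.\<close>

definition kernel_form ::
    "(complex ^ 'n) measure \<Rightarrow> (complex ^ 'n \<Rightarrow> complex) \<Rightarrow> (complex ^ 'n \<Rightarrow> complex ^ 'n \<Rightarrow> complex) \<Rightarrow> complex" where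
  "kernel_form M P K = (LINT x|M. (LINT y|M. K x y * P y) * P x)"

lemma kernel_form_prod: "kernel_form M P (\<lambda>x y. u x * v y) = (LINT z|M. u z * P z) * (LINT z|M. v z * P z)"
proof -
  have "kernel_form M P (\<lambda>x y. u x * v y) = (LINT x|M. (u x * P x) * (LINT y|M. v y * P y))"
    unfolding kernel_form_def mult.assoc integral_mult_right_zero by (simp only: mult.commute[of "P _"] mult.assoc)
  then show ?thesis unfolding integral_mult_left_zero .
qed

lemma kernel_form_scale: "kernel_form M P (\<lambda>x y. c * K x y) = c * kernel_form M P K"
  unfolding kernel_form_def mult.assoc integral_mult_right_zero ..

lemma finite_rank_integrable:
  assumes "finite_rank K" and M: "finite_measure M" "sets M = sets sphere_borel"
    and P: "continuous_on (sphere 0 1) P"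
  shows "integrable M (\<lambda>y. K x y * P y)" "integrable M (\<lambda>x. (LINT y|M. K x y * P y) * P x)"
proof -
  have "(\<forall>x. integrable M (\<lambda>y. K x y * P y)) \<and> integrable M (\<lambda>x. (LINT y|M. K x y * P y) * P x)"
    using assms(1)
  proof induction
    case (finite_rank_prod u v)
    then have uv: "continuous_on (sphere 0 1) u" "continuous_on (sphere 0 1) v"
      by (auto intro: continuous_on_subset)
    have "integrable M (\<lambda>y. v y * P y)" using uv P
      by (intro integrable_continuous_sphere[OF M] continuous_intros)
    moreover have "integrable M (\<lambda>x. (u x * (LINT y|M. v y * P y)) * P x)" using uv P
      by (intro integrable_continuous_sphere[OF M] continuous_intros)
    ultimately show ?case by (simp add: mult.assoc)
  next
    case (finite_rank_add K1 K2)
    then have "(\<lambda>x. (LINT y|M. (K1 x y + K2 x y) * P y) * P x)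
      = (\<lambda>x. (LINT y|M. K1 x y * P y) * P x + (LINT y|M. K2 x y * P y) * P x)"
      by (simp add: distrib_right)
    with finite_rank_add show ?case by (simp add: distrib_right)
  qed
  then show "integrable M (\<lambda>y. K x y * P y)" "integrable M (\<lambda>x. (LINT y|M. K x y * P y) * P x)" by auto
qed

lemma kernel_form_add:
  assumes "finite_rank K" "finite_rank K'" and M: "finite_measure M" "sets M = sets sphere_borel"
    and P: "continuous_on (sphere 0 1) P"
  shows "kernel_form M P (\<lambda>x y. K x y + K' x y) = kernel_form M P K + kernel_form M P K'"
  using finite_rank_integrable[OF assms(1) M P] finite_rank_integrable[OF assms(2) M P]
  by (simp add: kernel_form_def distrib_right)

lemma kernel_form_sum:
  assumes "\<And>i. i \<in> I \<Longrightarrow> finite_rank (K i)" and M: "finite_measure M" "sets M = sets sphere_borel"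
    and P: "continuous_on (sphere 0 1) P"
  shows "kernel_form M P (\<lambda>x y. \<Sum>i\<in>I. K i x y) = (\<Sum>i\<in>I. kernel_form M P (K i))"
  using assms(1)
proof (induction I rule: infinite_finite_induct)
  case (insert i I)
  then show ?case by (simp add: kernel_form_add[OF _ _ M P] finite_rank_sum)
qed (simp_all add: kernel_form_def)

text \<open>For a product kernel the form is a product of two integrals of continuous functions,
  each of which converges by hypothesis; sums follow by additivity.\<close>

lemma kernel_form_tendsto:
  assumes "finite_rank K"
    and \<mu>: "finite_measure \<mu>" "sets \<mu> = sets sphere_borel"
    and P: "\<And>N. continuous_on (sphere 0 1) (P N)"
    and lim: "\<And>f :: complex ^ 'n \<Rightarrow> complex. continuous_on (sphere 0 1) f \<Longrightarrow>
        (\<lambda>N. LINT z|sphere_measure. f z * P N z) \<longlonglongrightarrow> (LINT z|\<mu>. f z)"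
  shows "(\<lambda>N. kernel_form sphere_measure (P N) K) \<longlonglongrightarrow> kernel_form \<mu> (\<lambda>_. 1) K"
  using assms(1)
proof induction
  case (finite_rank_prod u v)
  then have uv: "continuous_on (sphere 0 1) u" "continuous_on (sphere 0 1) v"
    by (auto intro: continuous_on_subset)
  then show ?case unfolding kernel_form_prod by (auto intro!: tendsto_mult lim)
next
  case (finite_rank_add K K')
  have \<sigma>: "finite_measure (sphere_measure :: (complex ^ 'n) measure)"
    by (rule prob_space.finite_measure[OF prob_space_sphere_measure])
  show ?case
    unfolding kernel_form_add[OF finite_rank_add(1,2) \<mu> continuous_on_const]
      kernel_form_add[OF finite_rank_add(1,2) \<sigma> sets_sphere_measure P]
    by (intro tendsto_add finite_rank_add.IH)
qed

section \<open>Isotypic components of a Riesz product\<close>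

lemma sum_shift_finite_support:
  fixes c \<phi> :: "int \<Rightarrow> 'a::comm_ring_1"
  assumes c: "\<And>m. \<bar>m\<bar> > s \<Longrightarrow> c m = 0" and s: "s \<ge> 0" "\<bar>d\<bar> \<le> e"
  shows "(\<Sum>m\<in>{-(s+e)..s+e}. c (m - d) * \<phi> m) = (\<Sum>m\<in>{-s..s}. c m * \<phi> (m + d))"
proof -
  have "(\<Sum>m\<in>{-s..s}. c m * \<phi> (m + d)) = (\<Sum>m\<in>{-s+d..s+d}. c (m - d) * \<phi> m)"
    by (rule sum.reindex_bij_witness[of _ "\<lambda>m. m - d" "\<lambda>m. m + d"]) auto
  also have "\<dots> = (\<Sum>m\<in>{-(s+e)..s+e}. c (m - d) * \<phi> m)"
    using s c by (intro sum.mono_neutral_left) auto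
  finally show ?thesis ..
qed

lemma abs_shift_ge:
  fixes m d s j :: int
  assumes "\<bar>m\<bar> \<le> s" "\<bar>d\<bar> = j" "2 * s < j" shows "j \<le> 2 * \<bar>m + d\<bar>"
  using assms by presburger

text \<open>What the estimate retains of \<open>a k * R (J k) z / 2\<close>: continuity, the circle
  character \<open>J k\<close>, and a bound \<open>w k\<close> on its squared modulus. The bound
  holds only almost everywhere because it comes from an essential supremum.\<close>

locale riesz_factors =
  fixes b :: "nat \<Rightarrow> complex ^ 'n \<Rightarrow> complex" and J :: "nat \<Rightarrow> nat" and w :: "nat \<Rightarrow> real"
  assumes J_pos: "k \<ge> 1 \<Longrightarrow> J k > 0"
    and lacunary: "k \<ge> 1 \<Longrightarrow> 3 * J k \<le> J (Suc k)"
    and b_cont: "k \<ge> 1 \<Longrightarrow> continuous_on (sphere 0 1) (b k)"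
    and b_char: "k \<ge> 1 \<Longrightarrow> z \<in> sphere 0 1 \<Longrightarrow> b k (cis \<theta> *s z) = cis (real (J k) * \<theta>) * b k z"
    and b_le: "k \<ge> 1 \<Longrightarrow> AE z in sphere_measure. (cmod (b k z))\<^sup>2 \<le> w k"
    and w_nonneg: "w k \<ge> 0"
begin

text \<open>The part of the \<open>N\<close>-fold product with circle character \<open>m\<close>:
  multiplying by \<open>cnj b + 1 + b\<close> shifts characters by \<open>- J\<close>, 0 and
  \<open>J\<close>.\<close>

fun component :: "nat \<Rightarrow> int \<Rightarrow> complex ^ 'n \<Rightarrow> complex" where
  "component 0 m z = (if m = 0 then 1 else 0)"
| "component (Suc N) m z = component N m z + b (Suc N) z * component N (m - int (J (Suc N))) z
     + cnj (b (Suc N) z) * component N (m + int (J (Suc N))) z"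

text \<open>A majorant of the squared modulus of the component. The recursion has no cross terms
  because the three shifted supports are disjoint.\<close>

fun weight :: "nat \<Rightarrow> int \<Rightarrow> real" where
  "weight 0 m = (if m = 0 then 1 else 0)"
| "weight (Suc N) m = weight N m
     + w (Suc N) * (weight N (m - int (J (Suc N))) + weight N (m + int (J (Suc N))))"

definition degree_bound :: "nat \<Rightarrow> int" where "degree_bound N = (\<Sum>k=1..N. int (J k))"

lemma degree_bound_0 [simp]: "degree_bound 0 = 0" by (simp add: degree_bound_def)

lemma degree_bound_Suc: "degree_bound (Suc N) = degree_bound N + int (J (Suc N))" by (simp add: degree_bound_def)

lemma degree_bound_nonneg: "degree_bound N \<ge> 0" by (simp add: degree_bound_def sum_nonneg)

text \<open>The ratio 3 enters here: adding \<open>2 * J\<close> to a number below \<open>J\<close>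
  stays below \<open>3 * J\<close>. Consequently the windows of radius \<open>degree_bound N\<close>
  around 0 and around plus or minus \<open>J (Suc N)\<close> are pairwise disjoint.\<close>

lemma degree_bound_less: "2 * degree_bound N < int (J (Suc N))"
proof (induction N)
  case 0 then show ?case using J_pos[of 1] by simp
next
  case (Suc N)
  then show ?case using lacunary[of "Suc N"] by (simp add: degree_bound_Suc)
qed

lemma component_support: "\<bar>m\<bar> > degree_bound N \<Longrightarrow> component N m z = 0"
proof (induction N arbitrary: m)
  case (Suc N)
  then show ?case by (simp add: degree_bound_Suc)
qed simp

lemma weight_support: "\<bar>m\<bar> > degree_bound N \<Longrightarrow> weight N m = 0"
proof (induction N arbitrary: m)
  case (Suc N)
  then show ?case by (simp add: degree_bound_Suc)
qed simp

lemma weight_nonneg: "weight N m \<ge> 0"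
  by (induction N arbitrary: m) (simp_all add: w_nonneg)

lemma weight_uminus: "weight N (- m) = weight N m"
proof (induction N arbitrary: m)
  case (Suc N)
  have "- m - int (J (Suc N)) = - (m + int (J (Suc N)))" "- m + int (J (Suc N)) = - (m - int (J (Suc N)))"
    by simp_all
  then show ?case by (simp only: weight.simps Suc.IH) simp
qed simp

lemma component_continuous: "continuous_on (sphere 0 1) (component N m)"
proof (induction N arbitrary: m)
  case 0
  have "component 0 m = (\<lambda>z. if m = 0 then 1 else 0)" by (rule ext) simp
  then show ?case by (simp add: continuous_on_const)
next
  case (Suc N)
  have "component (Suc N) m = (\<lambda>z. component N m z + b (Suc N) z * component N (m - int (J (Suc N))) z
     + cnj (b (Suc N) z) * component N (m + int (J (Suc N))) z)" by (rule ext) simp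
  moreover have "continuous_on (sphere 0 1) \<dots>"
    by (intro continuous_intros Suc.IH b_cont) auto
  ultimately show ?case by metis
qed

lemma component_char: "z \<in> sphere 0 1 \<Longrightarrow> component N m (cis \<theta> *s z) = cis (of_int m * \<theta>) * component N m z"
proof (induction N arbitrary: m)
  case (Suc N)
  let ?J = "J (Suc N)" and ?b = "b (Suc N) z"
  have b: "b (Suc N) (cis \<theta> *s z) = cis (real ?J * \<theta>) * ?b"
    using Suc.prems by (intro b_char) simp_all
  have c: "cis (real ?J * \<theta>) * cis (of_int (m - int ?J) * \<theta>) = cis (of_int m * \<theta>)"
    "cnj (cis (real ?J * \<theta>)) * cis (of_int (m + int ?J) * \<theta>) = cis (of_int m * \<theta>)"
    by (simp_all add: cis_mult cis_cnj algebra_simps)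
  have "(cis (real ?J * \<theta>) * ?b) * (cis (of_int (m - int ?J) * \<theta>) * component N (m - int ?J) z)
       = (cis (real ?J * \<theta>) * cis (of_int (m - int ?J) * \<theta>)) * (?b * component N (m - int ?J) z)"
    "cnj (cis (real ?J * \<theta>) * ?b) * (cis (of_int (m + int ?J) * \<theta>) * component N (m + int ?J) z)
       = (cnj (cis (real ?J * \<theta>)) * cis (of_int (m + int ?J) * \<theta>)) * (cnj ?b * component N (m + int ?J) z)"
    by (simp_all only: complex_cnj_mult mult_ac)
  then show ?case
    unfolding component.simps b Suc.IH[OF Suc.prems] c by (simp only: distrib_left mult.assoc)
qed simp

text \<open>By disjointness of the windows at most one of the three terms of the recursion is
  nonzero at a given \<open>m\<close>, so the square of the sum is the square of that term.\<close>

lemma component_le: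
  assumes "\<And>k. k \<ge> 1 \<Longrightarrow> (cmod (b k z))\<^sup>2 \<le> w k"
  shows "(cmod (component N m z))\<^sup>2 \<le> weight N m"
proof (induction N arbitrary: m)
  case (Suc N)
  let ?J = "int (J (Suc N))"
  have J: "2 * degree_bound N < ?J" by (rule degree_bound_less)
  note degree_bound0 = degree_bound_nonneg[of N]
  have bw: "(cmod (b (Suc N) z))\<^sup>2 \<le> w (Suc N)" by (rule assms) simp
  consider "\<bar>m\<bar> \<le> degree_bound N" | "\<bar>m\<bar> > degree_bound N" "\<bar>m - ?J\<bar> \<le> degree_bound N" | "\<bar>m\<bar> > degree_bound N" "\<bar>m - ?J\<bar> > degree_bound N" by linarith
  then show ?case
  proof cases
    case 1
    with J degree_bound0 have "\<bar>m - ?J\<bar> > degree_bound N" "\<bar>m + ?J\<bar> > degree_bound N" by linarith+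
    then show ?thesis using Suc.IH[of m] by (simp add: component_support weight_support)
  next
    case 2
    with J degree_bound0 have "\<bar>m + ?J\<bar> > degree_bound N" by linarith
    then have c: "component (Suc N) m z = b (Suc N) z * component N (m - ?J) z"
      and w: "weight (Suc N) m = w (Suc N) * weight N (m - ?J)"
      using 2 by (simp_all add: component_support weight_support)
    show ?thesis
      unfolding c w norm_mult power_mult_distrib
      by (intro mult_mono bw Suc.IH w_nonneg zero_le_power2)
  next
    case 3
    then have c: "component (Suc N) m z = cnj (b (Suc N) z) * component N (m + ?J) z"
      and w: "weight (Suc N) m = w (Suc N) * weight N (m + ?J)"
      by (simp_all add: component_support weight_support)
    show ?thesis
      unfolding c w norm_mult power_mult_distrib complex_mod_cnj
      by (intro mult_mono bw Suc.IH w_nonneg zero_le_power2)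
  qed
qed simp

lemma component_AE_le: "AE z in sphere_measure. cmod (component N m z) \<le> sqrt (weight N m)"
proof -
  have "AE z in sphere_measure. \<forall>k\<in>{1..}. (cmod (b k z))\<^sup>2 \<le> w k"
    by (rule AE_ball_countable[THEN iffD2]) (auto simp: b_le)
  then show ?thesis
  proof eventually_elim
    case (elim z)
    then have "(cmod (component N m z))\<^sup>2 \<le> weight N m" by (intro component_le) auto
    then show ?case by (rule real_le_rsqrt)
  qed
qed

lemma prod_eq_sum_component:
  "(\<Prod>k=1..N. cnj (b k z) + 1 + b k z) = (\<Sum>m\<in>{- degree_bound N..degree_bound N}. component N m z)"
proof (induction N)
  case (Suc N)
  let ?J = "int (J (Suc N))" and ?I = "{- degree_bound (Suc N)..degree_bound (Suc N)}"
  have I: "?I = {-(degree_bound N + ?J)..degree_bound N + ?J}" by (simp add: degree_bound_Suc)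
  have shift: "(\<Sum>m\<in>?I. component N (m - d) z) = (\<Sum>m\<in>{- degree_bound N..degree_bound N}. component N m z)" if "\<bar>d\<bar> \<le> ?J" for d
    using sum_shift_finite_support[of "degree_bound N" "\<lambda>m. component N m z" d ?J "\<lambda>_. 1"] that degree_bound_nonneg component_support
    unfolding I by simp
  have "(\<Sum>m\<in>?I. component (Suc N) m z) = (\<Sum>m\<in>?I. component N (m - 0) z) + b (Suc N) z * (\<Sum>m\<in>?I. component N (m - ?J) z)
      + cnj (b (Suc N) z) * (\<Sum>m\<in>?I. component N (m - (- ?J)) z)"
    by (simp add: sum.distrib sum_distrib_left)
  also have "\<dots> = (\<Sum>m\<in>{- degree_bound N..degree_bound N}. component N m z) * (cnj (b (Suc N) z) + 1 + b (Suc N) z)"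
    by (subst (1 2 3) shift) (auto simp: algebra_simps)
  finally show ?case using Suc by simp
qed simp

lemma weight_sum_Suc:
  fixes \<phi> :: "int \<Rightarrow> real"
  shows "(\<Sum>m\<in>{- degree_bound (Suc N)..degree_bound (Suc N)}. weight (Suc N) m * \<phi> m)
    = (\<Sum>m\<in>{- degree_bound N..degree_bound N}. weight N m * \<phi> m)
      + w (Suc N) * ((\<Sum>m\<in>{- degree_bound N..degree_bound N}. weight N m * \<phi> (m + int (J (Suc N))))
                   + (\<Sum>m\<in>{- degree_bound N..degree_bound N}. weight N m * \<phi> (m - int (J (Suc N)))))"
proof -
  let ?J = "int (J (Suc N))" and ?I = "{- degree_bound (Suc N)..degree_bound (Suc N)}"
  have I: "?I = {-(degree_bound N + ?J)..degree_bound N + ?J}" by (simp add: degree_bound_Suc)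
  have shift: "(\<Sum>m\<in>?I. weight N (m - d) * \<phi> m) = (\<Sum>m\<in>{- degree_bound N..degree_bound N}. weight N m * \<phi> (m + d))" if "\<bar>d\<bar> \<le> ?J" for d
    unfolding I by (rule sum_shift_finite_support) (use that degree_bound_nonneg weight_support in auto)
  have "(\<Sum>m\<in>?I. weight (Suc N) m * \<phi> m) = (\<Sum>m\<in>?I. weight N (m - 0) * \<phi> m)
     + w (Suc N) * ((\<Sum>m\<in>?I. weight N (m - ?J) * \<phi> m) + (\<Sum>m\<in>?I. weight N (m - (- ?J)) * \<phi> m))"
    by (simp add: sum.distrib sum_distrib_left algebra_simps)
  also have "\<dots> = (\<Sum>m\<in>{- degree_bound N..degree_bound N}. weight N m * \<phi> m)
      + w (Suc N) * ((\<Sum>m\<in>{- degree_bound N..degree_bound N}. weight N m * \<phi> (m + ?J))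
                   + (\<Sum>m\<in>{- degree_bound N..degree_bound N}. weight N m * \<phi> (m - ?J)))"
    by (subst (1 2 3) shift) auto
  finally show ?thesis .
qed

lemma weight_total: "(\<Sum>m\<in>{- degree_bound N..degree_bound N}. weight N m) = (\<Prod>k\<in>{1..N}. 1 + 2 * w k)"
proof (induction N)
  case (Suc N)
  then show ?case using weight_sum_Suc[of N "\<lambda>_. 1"] by (simp add: algebra_simps)
qed simp

text \<open>Factor \<open>k\<close> moves the total mass of the previous stage,
  \<open>\<Prod>l<k. 1 + 2 * w l\<close>, to each of two windows around plus and minus
  \<open>J k\<close>, scaled by \<open>w k\<close>. By lacunarity all indices there have modulus at
  least \<open>J k / 2\<close>, where \<open>\<phi>\<close> is bounded by
  \<open>\<Phi> k\<close>.\<close>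

lemma weight_sum_le:
  fixes \<phi> :: "int \<Rightarrow> real" and \<Phi> :: "nat \<Rightarrow> real"
  assumes \<Phi>: "\<And>k m. k \<ge> 1 \<Longrightarrow> int (J k) \<le> 2 * \<bar>m\<bar> \<Longrightarrow> \<phi> m \<le> \<Phi> k"
  shows "(\<Sum>m\<in>{- degree_bound N..degree_bound N}. weight N m * \<phi> m)
    \<le> \<phi> 0 + (\<Sum>k=1..N. 2 * w k * (\<Prod>l\<in>{1..<k}. 1 + 2 * w l) * \<Phi> k)"
proof (induction N)
  case (Suc N)
  let ?J = "int (J (Suc N))" and ?I = "{- degree_bound N..degree_bound N}"
  have le: "(\<Sum>m\<in>?I. weight N m * \<phi> (m + d)) \<le> (\<Sum>m\<in>?I. weight N m) * \<Phi> (Suc N)" if d: "\<bar>d\<bar> = ?J" for d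
    unfolding sum_distrib_right
  proof (rule sum_mono)
    fix m assume "m \<in> ?I"
    then have "\<bar>m\<bar> \<le> degree_bound N" by auto
    then have "int (J (Suc N)) \<le> 2 * \<bar>m + d\<bar>"
      by (rule abs_shift_ge[OF _ d degree_bound_less])
    then show "weight N m * \<phi> (m + d) \<le> weight N m * \<Phi> (Suc N)"
      by (intro mult_left_mono \<Phi> weight_nonneg) auto
  qed
  have "(\<Sum>m\<in>{- degree_bound (Suc N)..degree_bound (Suc N)}. weight (Suc N) m * \<phi> m)
    \<le> (\<Sum>m\<in>?I. weight N m * \<phi> m) + w (Suc N) * ((\<Sum>m\<in>?I. weight N m) * \<Phi> (Suc N) + (\<Sum>m\<in>?I. weight N m) * \<Phi> (Suc N))"
    unfolding weight_sum_Suc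
  proof (intro add_left_mono mult_left_mono add_mono)
    show "(\<Sum>m\<in>?I. weight N m * \<phi> (m + ?J)) \<le> (\<Sum>m\<in>?I. weight N m) * \<Phi> (Suc N)"
      by (rule le) simp
    show "(\<Sum>m\<in>?I. weight N m * \<phi> (m - ?J)) \<le> (\<Sum>m\<in>?I. weight N m) * \<Phi> (Suc N)"
      using le[of "- ?J"] by simp
  qed (rule w_nonneg)
  also have "\<dots> = (\<Sum>m\<in>?I. weight N m * \<phi> m) + 2 * w (Suc N) * (\<Prod>l\<in>{1..<Suc N}. 1 + 2 * w l) * \<Phi> (Suc N)"
    by (simp add: weight_total atLeastLessThanSuc_atLeastAtMost)
  finally show ?case using Suc by simp
qed simp

end

section \<open>Monomial kernels tested against the partial products\<close>

lemma finite_rank_continuous: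
  assumes "finite_rank K" and M: "finite_measure M" "sets M = sets sphere_borel"
    and P: "continuous_on (sphere 0 1) P"
  shows "continuous_on UNIV (\<lambda>x. LINT y|M. K x y * P y)"
  using assms(1)
proof induction
  case (finite_rank_prod u v)
  then show ?case by (simp add: mult.assoc continuous_on_mult_right)
next
  case (finite_rank_add K1 K2)
  then show ?case
    using finite_rank_integrable(1)[OF finite_rank_add(1) M P] finite_rank_integrable(1)[OF finite_rank_add(2) M P]
    by (simp add: distrib_right continuous_on_add)
qed

lemma norm_integral_le_AE:
  fixes f :: "'a \<Rightarrow> complex" and g :: "'a \<Rightarrow> real"
  assumes "integrable M f" "integrable M g" "AE x in M. cmod (f x) \<le> g x"
  shows "cmod (LINT x|M. f x) \<le> (LINT x|M. g x)"
proof -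
  have "cmod (LINT x|M. f x) \<le> (LINT x|M. cmod (f x))" by (rule integral_norm_bound)
  also have "\<dots> \<le> (LINT x|M. g x)" using assms by (intro integral_mono_AE integrable_norm) auto
  finally show ?thesis .
qed

definition monomial_kernel :: "nat \<Rightarrow> nat \<Rightarrow> complex ^ 'n \<Rightarrow> complex ^ 'n \<Rightarrow> complex" where
  "monomial_kernel p q x y = hinner x y ^ p * cnj (hinner x y) ^ q"

lemma finite_rank_monomial_kernel: "finite_rank (monomial_kernel p q)"
proof -
  have "finite_rank (\<lambda>x y :: complex ^ 'n. hinner x y ^ p * cnj (hinner x y) ^ q)"
    using finite_rank_hinner finite_rank_cnj_hinner
    by (intro finite_rank_mult finite_rank_power) auto
  then show ?thesis by (simp add: monomial_kernel_def[abs_def])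
qed

lemma cis_power_cnj_power: "cis \<theta> ^ p * cnj (cis \<theta>) ^ q = cis (of_int (int p - int q) * \<theta>)"
proof -
  have "cis \<theta> ^ p * cnj (cis \<theta>) ^ q = cis (real p * \<theta>) * cis (real q * (- \<theta>))"
    by (simp add: Complex.DeMoivre cis_cnj)
  also have "\<dots> = cis (of_int (int p - int q) * \<theta>)" by (simp add: cis_mult algebra_simps)
  finally show ?thesis .
qed

lemma monomial_kernel_phase_left:
  "monomial_kernel p q (cis \<theta> *s x) y = cis (of_int (int p - int q) * \<theta>) * monomial_kernel p q x y"
proof -
  have "monomial_kernel p q (cis \<theta> *s x) y = (cis \<theta> ^ p * cnj (cis \<theta>) ^ q) * monomial_kernel p q x y"
    by (simp only: monomial_kernel_def hinner_scale_left complex_cnj_mult power_mult_distrib mult_ac)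
  then show ?thesis by (simp only: cis_power_cnj_power)
qed

lemma monomial_kernel_phase_right:
  "monomial_kernel p q x (cis \<theta> *s y) = cis (- of_int (int p - int q) * \<theta>) * monomial_kernel p q x y"
proof -
  have "monomial_kernel p q x (cis \<theta> *s y) = (cis (- \<theta>) ^ p * cnj (cis (- \<theta>)) ^ q) * monomial_kernel p q x y"
    by (simp only: monomial_kernel_def hinner_scale_right complex_cnj_mult complex_cnj_cnj cis_cnj minus_minus power_mult_distrib mult_ac)
  then show ?thesis by (simp only: cis_power_cnj_power mult_minus_right mult_minus_left)
qed

lemma cmod_monomial_kernel: "cmod (monomial_kernel p q x y) = cmod (hinner x y) ^ (p + q)"
  by (simp add: monomial_kernel_def norm_mult norm_power power_add)

context riesz_factors
begin

definition partial_product :: "nat \<Rightarrow> complex ^ 'n \<Rightarrow> complex" where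
  "partial_product N z = (\<Prod>k=1..N. cnj (b k z) + 1 + b k z)"

lemma partial_product_eq: "partial_product N z = (\<Sum>m\<in>{- degree_bound N..degree_bound N}. component N m z)"
  unfolding partial_product_def by (rule prod_eq_sum_component)

lemma partial_product_continuous: "continuous_on (sphere 0 1) (partial_product N)"
proof -
  have "continuous_on (sphere 0 1) (\<lambda>z. \<Sum>m\<in>{- degree_bound N..degree_bound N}. component N m z)"
    by (intro continuous_on_sum component_continuous)
  then show ?thesis by (simp add: partial_product_eq[abs_def])
qed

text \<open>Orthogonality of characters: the product with the component of index \<open>m\<close>
  has character \<open>k + m\<close> and hence mean zero unless \<open>m = - k\<close>. An index
  outside the window is harmless because its component vanishes.\<close>

lemma integral_character_partial_product:
  assumes f: "continuous_on (sphere 0 1) f"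
    and char: "\<And>\<theta> z. z \<in> sphere 0 1 \<Longrightarrow> f (cis \<theta> *s z) = cis (of_int k * \<theta>) * f z"
  shows "(LINT z|sphere_measure. f z * partial_product N z) = (LINT z|sphere_measure. f z * component N (- k) z)"
proof -
  have \<sigma>: "finite_measure (sphere_measure :: (complex ^ 'n) measure)"
    by (rule prob_space.finite_measure[OF prob_space_sphere_measure])
  have zero: "(LINT z|sphere_measure. f z * component N m z) = 0" if "m \<noteq> - k" for m
  proof (rule integral_sphere_measure_character)
    show "(\<lambda>z. f z * component N m z) \<in> borel_measurable sphere_measure"
      by (intro borel_measurable_sphere_continuous continuous_on_mult f component_continuous)
    show "k + m \<noteq> 0" using that by linarith
    fix \<theta> z assume z: "z \<in> sphere (0 :: complex ^ 'n) 1"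
    have "cis (of_int k * \<theta>) * cis (of_int m * \<theta>) = cis (of_int (k + m) * \<theta>)"
      by (simp add: cis_mult algebra_simps)
    then have c: "cis (of_int (k + m) * \<theta>) = cis (of_int k * \<theta>) * cis (of_int m * \<theta>)" ..
    show "f (cis \<theta> *s z) * component N m (cis \<theta> *s z) = cis (of_int (k + m) * \<theta>) * (f z * component N m z)"
      unfolding char[OF z] component_char[OF z] c by (simp only: mult_ac)
  qed
  have "(LINT z|sphere_measure. f z * partial_product N z) = (\<Sum>m\<in>{- degree_bound N..degree_bound N}. LINT z|sphere_measure. f z * component N m z)"
    unfolding partial_product_eq sum_distrib_left
    by (intro Bochner_Integration.integral_sum integrable_continuous_sphere[OF \<sigma>] continuous_on_mult f component_continuous) simp
  also have "\<dots> = (\<Sum>m\<in>{- degree_bound N..degree_bound N} \<inter> {- k}. LINT z|sphere_measure. f z * component N m z)"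
    using zero by (intro sum.mono_neutral_right) auto
  also have "\<dots> = (LINT z|sphere_measure. f z * component N (- k) z)"
  proof (cases "- k \<in> {- degree_bound N..degree_bound N}")
    case False
    then have "component N (- k) z = 0" for z by (intro component_support) auto
    with False show ?thesis by simp
  qed simp
  finally show ?thesis .
qed

text \<open>Orthogonality in \<open>y\<close> selects the component of index \<open>p - q\<close>;
  the inner integral inherits a character in \<open>x\<close>, and orthogonality there selects index
  \<open>q - p\<close>. Both components are almost everywhere at most the square root of the same
  weight, which makes the bound linear in the weight. The remaining integral of the kernel's modulus
  over \<open>y\<close> is a moment.\<close>

lemma kernel_form_monomial_le:
  assumes C: "\<And>(x :: complex ^ 'n) j. x \<in> sphere 0 1 \<Longrightarrow>
       (LINT y|sphere_measure. cmod (hinner x y) ^ j) \<le> M j"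
  shows "cmod (kernel_form sphere_measure (partial_product N) (monomial_kernel p q)) \<le> weight N (int p - int q) * M (p + q)"
proof -
  interpret \<sigma>: prob_space "sphere_measure :: (complex ^ 'n) measure" by (rule prob_space_sphere_measure)
  have \<sigma>: "finite_measure (sphere_measure :: (complex ^ 'n) measure)" by (rule \<sigma>.finite_measure)
  let ?d = "int p - int q" and ?K = "monomial_kernel p q :: complex ^ 'n \<Rightarrow> _"
  define B where "B = sqrt (weight N ?d)"
  have B: "B \<ge> 0" "B * B = weight N ?d" using weight_nonneg by (simp_all add: B_def)
  have AE1: "AE z in sphere_measure. cmod (component N ?d z) \<le> B" unfolding B_def by (rule component_AE_le)
  have AE2: "AE z in sphere_measure. cmod (component N (- ?d) z) \<le> B"
    unfolding B_def using component_AE_le[of N "- ?d"] by (simp only: weight_uminus)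
  define G where "G x = (LINT y|sphere_measure. ?K x y * component N ?d y)" for x
  have Kc: "continuous_on (sphere 0 1) (?K x)" for x
    unfolding monomial_kernel_def[abs_def] by (intro continuous_intros)
  have hc: "continuous_on (sphere 0 1) (\<lambda>y. cmod (hinner x y) ^ (p + q))" for x :: "complex ^ 'n"
    by (intro continuous_intros)
  have Gc: "continuous_on (sphere 0 1) G"
    unfolding G_def using finite_rank_continuous[OF finite_rank_monomial_kernel \<sigma> sets_sphere_measure component_continuous]
    by (rule continuous_on_subset) simp
  have "(LINT y|sphere_measure. ?K x y * partial_product N y) = G x" for x
  proof -
    have "(LINT y|sphere_measure. ?K x y * partial_product N y) = (LINT y|sphere_measure. ?K x y * component N (- (- ?d)) y)"
    proof (rule integral_character_partial_product[OF Kc])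
      fix \<theta> z
      show "?K x (cis \<theta> *s z) = cis (of_int (- ?d) * \<theta>) * ?K x z"
        by (simp only: monomial_kernel_phase_right of_int_minus)
    qed
    then show ?thesis by (simp add: G_def)
  qed
  then have "kernel_form sphere_measure (partial_product N) ?K = (LINT x|sphere_measure. G x * partial_product N x)"
    by (simp add: kernel_form_def)
  also have "\<dots> = (LINT x|sphere_measure. G x * component N (- ?d) x)"
  proof (rule integral_character_partial_product[OF Gc])
    fix \<theta> z
    show "G (cis \<theta> *s z) = cis (of_int ?d * \<theta>) * G z"
      unfolding G_def monomial_kernel_phase_left mult.assoc integral_mult_right_zero ..
  qed
  also have "cmod \<dots> \<le> (LINT x|(sphere_measure :: (complex ^ 'n) measure). (B * M (p + q)) * B)"
  proof (rule norm_integral_le_AE)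
    have G: "cmod (G x) \<le> B * M (p + q)" if x: "x \<in> sphere 0 1" for x
    proof -
      have "cmod (G x) \<le> (LINT y|sphere_measure. B * cmod (hinner x y) ^ (p + q))"
        unfolding G_def
      proof (rule norm_integral_le_AE)
        show "AE y in sphere_measure. cmod (?K x y * component N ?d y) \<le> B * cmod (hinner x y) ^ (p + q)"
          using AE1
        proof eventually_elim
          case (elim y)
          then show ?case unfolding norm_mult cmod_monomial_kernel
            by (subst mult.commute) (intro mult_right_mono; simp)
        qed
      qed (intro integrable_continuous_sphere[OF \<sigma>] continuous_on_mult Kc hc component_continuous continuous_on_const; simp)+
      also have "\<dots> = B * (LINT y|sphere_measure. cmod (hinner x y) ^ (p + q))" by simp
      also have "\<dots> \<le> B * M (p + q)" using C[OF x] B(1) by (intro mult_left_mono)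
      finally show ?thesis .
    qed
    show "AE x in sphere_measure. cmod (G x * component N (- ?d) x) \<le> (B * M (p + q)) * B"
      using AE2 AE_space
    proof eventually_elim
      case (elim x)
      then have "cmod (G x) \<le> B * M (p + q)" by (intro G) simp
      moreover from this have "0 \<le> B * M (p + q)" by (rule order_trans[OF norm_ge_zero])
      ultimately show ?case unfolding norm_mult using elim by (intro mult_mono) auto
    qed
    show "integrable sphere_measure (\<lambda>x. G x * component N (- ?d) x)"
      by (intro integrable_continuous_sphere[OF \<sigma>] continuous_on_mult Gc component_continuous) simp
  qed simp
  also have "\<dots> = (B * B) * M (p + q)" using \<sigma>.prob_space by simp
  finally show ?thesis unfolding B(2) .
qed

end

section \<open>The energy estimate\<close>

definition truncated_kernel :: "real \<Rightarrow> real \<Rightarrow> nat \<Rightarrow> complex ^ 'n \<Rightarrow> complex ^ 'n \<Rightarrow> complex" where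
  "truncated_kernel t r L x y = (\<Sum>j<L. \<Sum>p\<le>j.
     complex_of_real (riesz_kernel_coeff t p (j - p) * r ^ j) * monomial_kernel p (j - p) x y)"

text \<open>Expand powers of \<open>x \<bullet> y\<close>, which is half of
  \<open>hinner x y\<close> plus its conjugate, by the binomial theorem; the coefficient definition
  absorbs the binomial coefficient and the powers of 2.\<close>

lemma truncated_kernel_eq:
  "truncated_kernel t r L x y =
     complex_of_real (\<Sum>j<L. pochhammer (t / 2) j / fact j * (r * (x \<bullet> y)) ^ j)"
proof -
  define h where "h = hinner x y"
  have Re: "h + cnj h = complex_of_real (2 * (x \<bullet> y))"
    by (simp add: h_def complex_add_cnj Re_hinner)
  have "(\<Sum>p\<le>j. complex_of_real (riesz_kernel_coeff t p (j - p) * r ^ j) * monomial_kernel p (j - p) x y)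
      = complex_of_real (pochhammer (t / 2) j / fact j * (r * (x \<bullet> y)) ^ j)" for j
  proof -
    have "complex_of_real (riesz_kernel_coeff t p (j - p) * r ^ j) * monomial_kernel p (j - p) x y
       = complex_of_real (pochhammer (t / 2) j / fact j * r ^ j / 2 ^ j) * (of_nat (j choose p) * h ^ p * cnj h ^ (j - p))"
      if "p \<in> {..j}" for p
    proof -
      have p: "p \<le> j" using that by simp
      have "real (j choose p) = fact j / (fact p * fact (j - p))" by (rule binomial_fact[OF p])
      then have "riesz_kernel_coeff t p (j - p) * r ^ j = pochhammer (t / 2) j / fact j * r ^ j / 2 ^ j * real (j choose p)"
        using p by (simp add: riesz_kernel_coeff_def field_simps)
      then have "complex_of_real (riesz_kernel_coeff t p (j - p) * r ^ j)
        = complex_of_real (pochhammer (t / 2) j / fact j * r ^ j / 2 ^ j) * of_nat (j choose p)"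
        by (simp only: of_real_mult of_real_of_nat_eq)
      then show ?thesis by (simp only: monomial_kernel_def h_def mult.assoc)
    qed
    then have "(\<Sum>p\<le>j. complex_of_real (riesz_kernel_coeff t p (j - p) * r ^ j) * monomial_kernel p (j - p) x y)
      = complex_of_real (pochhammer (t / 2) j / fact j * r ^ j / 2 ^ j) * (\<Sum>p\<le>j. of_nat (j choose p) * h ^ p * cnj h ^ (j - p))"
      by (simp only: sum_distrib_left cong: sum.cong)
    also have "(\<Sum>p\<le>j. of_nat (j choose p) * h ^ p * cnj h ^ (j - p)) = complex_of_real ((2 * (x \<bullet> y)) ^ j)"
      unfolding binomial_ring[symmetric] Re by simp
    also have "complex_of_real (pochhammer (t / 2) j / fact j * r ^ j / 2 ^ j) * complex_of_real ((2 * (x \<bullet> y)) ^ j)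
      = complex_of_real (pochhammer (t / 2) j / fact j * r ^ j / 2 ^ j * (2 * (x \<bullet> y)) ^ j)"
      by (simp only: of_real_mult)
    also have "pochhammer (t / 2) j / fact j * r ^ j / 2 ^ j * (2 * (x \<bullet> y)) ^ j
      = pochhammer (t / 2) j / fact j * (r * (x \<bullet> y)) ^ j"
      by (simp add: power_mult_distrib)
    finally show ?thesis .
  qed
  then show ?thesis by (simp only: truncated_kernel_def of_real_sum)
qed

lemma finite_rank_truncated_kernel: "finite_rank (truncated_kernel t r L)"
proof -
  have "finite_rank (\<lambda>x y :: complex ^ 'n. \<Sum>j<L. \<Sum>p\<le>j.
     complex_of_real (riesz_kernel_coeff t p (j - p) * r ^ j) * monomial_kernel p (j - p) x y)"
    by (intro finite_rank_sum finite_rank_mult finite_rank_const finite_rank_monomial_kernel)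
  then show ?thesis by (simp only: truncated_kernel_def[abs_def])
qed

text \<open>The triangle of pairs with \<open>p + q < L\<close> is cut into diagonals of constant
  \<open>p - q\<close>. Symmetry of \<open>g\<close> reduces a diagonal to its absolute difference,
  and the support of \<open>c\<close> leaves finitely many diagonals.\<close>

lemma sum_by_degree_difference_le:
  fixes g :: "nat \<Rightarrow> nat \<Rightarrow> real" and c \<phi> :: "int \<Rightarrow> real"
  assumes g: "\<And>p q. g p q \<ge> 0" "\<And>p q. g p q = g q p"
    and le: "\<And>m L. (\<Sum>q<L. g (m + q) q) \<le> \<phi> (int m)" and \<phi>: "\<And>m. \<phi> (- m) = \<phi> m"
    and c: "\<And>m. c m \<ge> 0" "\<And>m. \<bar>m\<bar> > s \<Longrightarrow> c m = 0"
  shows "(\<Sum>j<L. \<Sum>p\<le>j. g p (j - p) * c (int p - int (j - p))) \<le> (\<Sum>m\<in>{-s..s}. c m * \<phi> m)"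
proof -
  define A where "A = (SIGMA j:{..<L}. {..j})"
  define d where "d a = int (snd a) - int (fst a - snd a)" for a :: "nat \<times> nat"
  define G where "G a = g (snd a) (fst a - snd a)" for a :: "nat \<times> nat"
  have A: "finite A" by (simp add: A_def)
  have "(\<Sum>j<L. \<Sum>p\<le>j. g p (j - p) * c (int p - int (j - p))) = (\<Sum>a\<in>A. G a * c (d a))"
    unfolding A_def G_def d_def by (subst sum.Sigma) (auto intro!: sum.cong)
  also have "\<dots> = (\<Sum>a\<in>A. \<Sum>m\<in>{-s..s}. if d a = m then G a * c m else 0)"
  proof (rule sum.cong[OF refl])
    fix a
    show "G a * c (d a) = (\<Sum>m\<in>{-s..s}. if d a = m then G a * c m else 0)"
    proof (cases "d a \<in> {-s..s}")
      case False
      then have "\<bar>d a\<bar> > s" by (simp add: abs_if split: if_splits) linarith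
      then have "c (d a) = 0" by (rule c(2))
      with False show ?thesis by (simp cong: if_cong)
    qed (simp add: sum.delta')
  qed
  also have "\<dots> = (\<Sum>m\<in>{-s..s}. \<Sum>a\<in>A. if d a = m then G a * c m else 0)" by (rule sum.swap)
  also have "\<dots> \<le> (\<Sum>m\<in>{-s..s}. c m * \<phi> m)"
  proof (rule sum_mono)
    fix m :: int
    \<comment> \<open>A pair is encoded as (total degree, \<open>p\<close>), so \<open>?f\<close> is
      the smaller of the two exponents, which parametrizes the diagonal injectively.\<close>
    let ?B = "{a \<in> A. d a = m}" and ?f = "\<lambda>a :: nat \<times> nat. min (snd a) (fst a - snd a)" and ?k = "nat \<bar>m\<bar>"
    have inj: "inj_on ?f ?B"
    proof (rule inj_onI)
      fix a a' assume "a \<in> ?B" "a' \<in> ?B" "?f a = ?f a'"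
      then show "a = a'"
        by (cases a; cases a') (auto simp: A_def d_def min_def split: if_splits)
    qed
    have "(\<Sum>a\<in>?B. G a) = (\<Sum>a\<in>?B. g (?k + ?f a) (?f a))"
    proof (rule sum.cong[OF refl])
      fix a assume a: "a \<in> ?B"
      obtain j p where jp: "a = (j, p)" by (cases a)
      show "G a = g (?k + ?f a) (?f a)"
      proof (cases "m \<ge> 0")
        case True
        then have "?f a = j - p" "?k + (j - p) = p" using a jp by (auto simp: A_def d_def)
        then show ?thesis by (simp add: G_def jp)
      next
        case False
        then have "?f a = p" "?k + p = j - p" using a jp by (auto simp: A_def d_def)
        then show ?thesis using g(2)[of p "j - p"] by (simp add: G_def jp)
      qed
    qed
    also have "\<dots> = (\<Sum>q\<in>?f ` ?B. g (?k + q) q)" by (simp add: sum.reindex[OF inj])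
    also have "\<dots> \<le> (\<Sum>q<L. g (?k + q) q)"
    proof (rule sum_mono2)
      show "?f ` ?B \<subseteq> {..<L}" by (auto simp: A_def)
    qed (auto simp: g)
    also have "\<dots> \<le> \<phi> (int ?k)" by (rule le)
    also have "\<phi> (int ?k) = \<phi> m" using \<phi>[of m] by (cases "m \<ge> 0") auto
    finally have "c m * (\<Sum>a\<in>?B. G a) \<le> c m * \<phi> m" by (rule mult_left_mono[OF _ c(1)])
    moreover have "(\<Sum>a\<in>A. if d a = m then G a * c m else 0) = c m * (\<Sum>a\<in>?B. G a)"
      unfolding sum.inter_filter[OF A] sum_distrib_left by (intro sum.cong refl) simp
    ultimately show "(\<Sum>a\<in>A. if d a = m then G a * c m else 0) \<le> c m * \<phi> m" by simp
  qed
  finally show ?thesis .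
qed

context riesz_factors
begin

text \<open>The constant \<open>C\<close> is chosen before \<open>N\<close>, \<open>r\<close> and
  \<open>L\<close>; this uniformity is what both limit passages need. The damping is discarded
  through \<open>r ^ j \<le> 1\<close>.\<close>

lemma kernel_form_truncated_le:
  assumes t: "0 < t" "t < 2 * real CARD('n) - 1"
  obtains C where "C > 0"
    "\<And>N r L. 0 < r \<Longrightarrow> r < 1 \<Longrightarrow> cmod (kernel_form sphere_measure (partial_product N) (truncated_kernel t r L))
        \<le> (\<Sum>m\<in>{- degree_bound N..degree_bound N}. weight N m * (C * (real_of_int \<bar>m\<bar> + 1) powr (t - (2 * real CARD('n) - 1))))"
proof -
  have \<sigma>: "finite_measure (sphere_measure :: (complex ^ 'n) measure)"
    by (rule prob_space.finite_measure[OF prob_space_sphere_measure])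
  note form_sum = kernel_form_sum[OF _ \<sigma> sets_sphere_measure partial_product_continuous]
  obtain C1 where C1: "C1 > 0" "\<And>(x :: complex ^ 'n) j. x \<in> sphere 0 1 \<Longrightarrow>
       (LINT y|sphere_measure. cmod (hinner x y) ^ j) \<le> C1 / (real j + 1) ^ (CARD('n) - 1)"
    using hinner_moment_le[where 'n = 'n] by blast
  obtain C2 where C2: "C2 > 0"
    "\<And>m L. (\<Sum>q<L. riesz_kernel_coeff t (m + q) q / (real (m + 2 * q) + 1) ^ (CARD('n) - 1))
             \<le> C2 * (real m + 1) powr (t - (2 * real CARD('n) - 1))"
    using riesz_kernel_coeff_sum_le[OF t] by blast
  define M where "M j = C1 / (real j + 1) ^ (CARD('n) - 1)" for j
  have M: "M j \<ge> 0" for j using C1 by (simp add: M_def)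
  define \<phi> where "\<phi> m = (C1 * C2) * (real_of_int \<bar>m\<bar> + 1) powr (t - (2 * real CARD('n) - 1))" for m :: int
  define g where "g p q = riesz_kernel_coeff t p q * M (p + q)" for p q
  show ?thesis
  proof (rule that[of "C1 * C2"])
    show "C1 * C2 > 0" using C1 C2 by simp
    fix N L and r :: real assume r: "0 < r" "r < 1"
    have "kernel_form sphere_measure (partial_product N) (truncated_kernel t r L) =
      (\<Sum>j<L. \<Sum>p\<le>j. complex_of_real (riesz_kernel_coeff t p (j - p) * r ^ j)
         * kernel_form sphere_measure (partial_product N) (monomial_kernel p (j - p)))"
      unfolding truncated_kernel_def[abs_def]
      by (subst form_sum, intro finite_rank_sum finite_rank_mult finite_rank_const finite_rank_monomial_kernel)+
         (simp only: form_sum finite_rank_mult finite_rank_const finite_rank_monomial_kernel kernel_form_scale)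
    also have "cmod \<dots> \<le> (\<Sum>j<L. \<Sum>p\<le>j. cmod (complex_of_real (riesz_kernel_coeff t p (j - p) * r ^ j)
         * kernel_form sphere_measure (partial_product N) (monomial_kernel p (j - p))))"
      by (intro order_trans[OF norm_sum] sum_mono norm_sum)
    also have "\<dots> \<le> (\<Sum>j<L. \<Sum>p\<le>j. g p (j - p) * weight N (int p - int (j - p)))"
    proof (intro sum_mono)
      fix j p :: nat assume "p \<in> {..j}"
      then have p: "p + (j - p) = j" by simp
      have k: "riesz_kernel_coeff t p (j - p) \<ge> 0" by (rule riesz_kernel_coeff_nonneg[OF t(1)])
      have rj: "r ^ j \<le> 1" "0 \<le> r ^ j" using r by (auto intro: power_le_one)
      have "cmod (kernel_form sphere_measure (partial_product N) (monomial_kernel p (j - p)))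
         \<le> weight N (int p - int (j - p)) * M (p + (j - p))"
        unfolding M_def by (rule kernel_form_monomial_le) (rule C1(2))
      then have "(riesz_kernel_coeff t p (j - p) * r ^ j) * cmod (kernel_form sphere_measure (partial_product N) (monomial_kernel p (j - p)))
         \<le> (riesz_kernel_coeff t p (j - p) * 1) * (weight N (int p - int (j - p)) * M (p + (j - p)))"
        using k rj by (intro mult_mono) auto
      moreover have "cmod (complex_of_real (riesz_kernel_coeff t p (j - p) * r ^ j)) = riesz_kernel_coeff t p (j - p) * r ^ j"
        using k rj by (simp only: norm_of_real abs_of_nonneg mult_nonneg_nonneg)
      ultimately show "cmod (complex_of_real (riesz_kernel_coeff t p (j - p) * r ^ j)
         * kernel_form sphere_measure (partial_product N) (monomial_kernel p (j - p))) \<le> g p (j - p) * weight N (int p - int (j - p))"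
        by (simp only: norm_mult g_def mult_1_right mult_ac)
    qed
    also have "\<dots> \<le> (\<Sum>m\<in>{- degree_bound N..degree_bound N}. weight N m * \<phi> m)"
    proof (rule sum_by_degree_difference_le)
      fix p q show "g p q \<ge> 0" unfolding g_def by (intro mult_nonneg_nonneg riesz_kernel_coeff_nonneg t M)
      show "g p q = g q p" unfolding g_def by (simp add: riesz_kernel_coeff_commute[of t p q] add.commute)
    next
      fix m K
      have "(\<Sum>q<K. g (m + q) q) = C1 * (\<Sum>q<K. riesz_kernel_coeff t (m + q) q / (real (m + 2 * q) + 1) ^ (CARD('n) - 1))"
        unfolding g_def M_def sum_distrib_left
      proof (intro sum.cong refl)
        fix q
        have "m + q + q = m + 2 * q" by simp
        then show "riesz_kernel_coeff t (m + q) q * (C1 / (real (m + q + q) + 1) ^ (CARD('n) - 1))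
          = C1 * (riesz_kernel_coeff t (m + q) q / (real (m + 2 * q) + 1) ^ (CARD('n) - 1))" by (simp only:) simp
      qed
      also have "\<dots> \<le> C1 * (C2 * (real m + 1) powr (t - (2 * real CARD('n) - 1)))"
        using C1 by (intro mult_left_mono C2) auto
      finally show "(\<Sum>q<K. g (m + q) q) \<le> \<phi> (int m)" by (simp add: \<phi>_def mult.assoc)
    qed (simp_all add: \<phi>_def weight_nonneg weight_support)
    finally show "cmod (kernel_form sphere_measure (partial_product N) (truncated_kernel t r L))
        \<le> (\<Sum>m\<in>{- degree_bound N..degree_bound N}. weight N m * ((C1 * C2) * (real_of_int \<bar>m\<bar> + 1) powr (t - (2 * real CARD('n) - 1))))"
      by (simp only: \<phi>_def)
  qed
qed

end

context riesz_factors
begin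

text \<open>The diagonal bound is a decreasing power of the index, so at indices of modulus at least
  \<open>J k / 2\<close> it is controlled by \<open>J k powr e\<close> up to
  \<open>2 powr (- e)\<close>. The index 0 contributes only the constant \<open>C\<close>.\<close>

lemma energy_finite:
  fixes \<mu> :: "(complex ^ 'n) measure"
  assumes t: "0 < t" "t < 2 * real CARD('n) - 1"
    and H: "\<And>N. (\<Sum>k=1..N. 2 * w k * (\<Prod>l\<in>{1..<k}. 1 + 2 * w l) * real (J k) powr (t - (2 * real CARD('n) - 1))) \<le> H"
    and \<mu>: "prob_space \<mu>" "sets \<mu> = sets sphere_borel"
    and lim: "\<And>f :: complex ^ 'n \<Rightarrow> complex. continuous_on (sphere 0 1) f \<Longrightarrow>
        (\<lambda>N. LINT z|sphere_measure. f z * partial_product N z) \<longlonglongrightarrow> (LINT z|\<mu>. f z)"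
  shows "energy t \<mu> < \<infinity>"
proof -
  define e where "e = t - (2 * real CARD('n) - 1)"
  have e: "e < 0" using t by (simp add: e_def)
  obtain C where C: "C > 0"
    "\<And>N r L. 0 < r \<Longrightarrow> r < 1 \<Longrightarrow> cmod (kernel_form sphere_measure (partial_product N) (truncated_kernel t r L))
        \<le> (\<Sum>m\<in>{- degree_bound N..degree_bound N}. weight N m * (C * (real_of_int \<bar>m\<bar> + 1) powr e))"
    unfolding e_def using kernel_form_truncated_le[OF t] by blast
  define D where "D = C * 2 powr (- e)"
  have D: "D \<ge> 0" using C by (simp add: D_def)
  have bound: "(\<Sum>m\<in>{- degree_bound N..degree_bound N}. weight N m * (C * (real_of_int \<bar>m\<bar> + 1) powr e)) \<le> C + D * H" for N
  proof -
    have "(\<Sum>m\<in>{- degree_bound N..degree_bound N}. weight N m * (C * (real_of_int \<bar>m\<bar> + 1) powr e))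
       \<le> C * (real_of_int \<bar>0\<bar> + 1) powr e + (\<Sum>k=1..N. 2 * w k * (\<Prod>l\<in>{1..<k}. 1 + 2 * w l) * (D * real (J k) powr e))"
    proof (rule weight_sum_le)
      fix k :: nat and m :: int
      assume k: "k \<ge> 1" and m: "int (J k) \<le> 2 * \<bar>m\<bar>"
      have Jk: "0 < real (J k)" using J_pos[OF k] by simp
      have "real_of_int (int (J k)) \<le> real_of_int (2 * \<bar>m\<bar>)" using m by (simp only: of_int_le_iff)
      then have "real (J k) / 2 \<le> real_of_int \<bar>m\<bar> + 1" by simp
      then have "(real_of_int \<bar>m\<bar> + 1) powr e \<le> (real (J k) / 2) powr e"
        using Jk e by (intro powr_mono2') auto
      also have "\<dots> = 2 powr (- e) * real (J k) powr e"
        using Jk by (simp add: powr_divide powr_minus field_simps)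
      finally show "C * (real_of_int \<bar>m\<bar> + 1) powr e \<le> D * real (J k) powr e"
        using C by (simp add: D_def mult.assoc)
    qed
    also have "(\<Sum>k=1..N. 2 * w k * (\<Prod>l\<in>{1..<k}. 1 + 2 * w l) * (D * real (J k) powr e))
      = D * (\<Sum>k=1..N. 2 * w k * (\<Prod>l\<in>{1..<k}. 1 + 2 * w l) * real (J k) powr e)"
      by (simp add: sum_distrib_left mult_ac)
    also have "C * (real_of_int \<bar>0\<bar> + 1) powr e + \<dots> \<le> C + D * H"
      using H[of N] D by (intro add_mono mult_left_mono) (auto simp: e_def)
    finally show ?thesis .
  qed
  have fin: "finite_measure \<mu>" by (rule prob_space.finite_measure[OF \<mu>(1)])
  have "energy t \<mu> \<le> ennreal (C + D * H)"
  proof (rule energy_le_truncated[OF \<mu> t(1)])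
    fix r :: real and L assume r: "0 < r" "r < 1"
    let ?I = "LINT x|\<mu>. LINT y|\<mu>. (\<Sum>j<L. pochhammer (t / 2) j / fact j * (r * (x \<bullet> y)) ^ j)"
    have "(\<lambda>N. kernel_form sphere_measure (partial_product N) (truncated_kernel t r L)) \<longlonglongrightarrow> kernel_form \<mu> (\<lambda>_. 1) (truncated_kernel t r L)"
      by (rule kernel_form_tendsto[OF finite_rank_truncated_kernel fin \<mu>(2) partial_product_continuous lim])
    then have "cmod (kernel_form \<mu> (\<lambda>_. 1) (truncated_kernel t r L)) \<le> C + D * H"
      by (rule LIMSEQ_le_const2[OF tendsto_norm]) (use C(2)[OF r] bound order_trans in blast)
    moreover have "kernel_form \<mu> (\<lambda>_. 1) (truncated_kernel t r L) = complex_of_real ?I"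
      unfolding kernel_form_def truncated_kernel_eq mult_1_right integral_complex_of_real ..
    ultimately have "\<bar>?I\<bar> \<le> C + D * H" by (simp only: norm_of_real)
    then show "?I \<le> C + D * H" by linarith
  qed
  also have "\<dots> < \<infinity>" by simp
  finally show ?thesis .
qed

end

section \<open>From Riesz triples to the abstract factors\<close>

lemma hol_hom_continuous:
  assumes "f \<in> hol_hom j" shows "continuous_on (sphere 0 1) f"
proof -
  obtain c where c: "\<And>z. z \<in> sphere 0 1 \<Longrightarrow>
     f z = (\<Sum>\<alpha> | (\<Sum>i\<in>UNIV. \<alpha> i) = j. c \<alpha> * (\<Prod>i\<in>UNIV. (z $ i) ^ \<alpha> i))"
    using assms unfolding hol_hom_def by blast
  have "continuous_on (sphere 0 1) (\<lambda>z. \<Sum>\<alpha> | (\<Sum>i\<in>UNIV. \<alpha> i) = j. c \<alpha> * (\<Prod>i\<in>UNIV. (z $ i) ^ \<alpha> i))"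
    by (intro continuous_intros)
  then show ?thesis using c by (subst continuous_on_cong[OF refl c]) auto
qed

lemma hol_hom_phase:
  assumes "f \<in> hol_hom j" "z \<in> sphere 0 1"
  shows "f (cis \<theta> *s z) = cis (real j * \<theta>) * f z"
proof -
  obtain c where c: "\<And>z. z \<in> sphere 0 1 \<Longrightarrow>
     f z = (\<Sum>\<alpha> | (\<Sum>i\<in>UNIV. \<alpha> i) = j. c \<alpha> * (\<Prod>i\<in>UNIV. (z $ i) ^ \<alpha> i))"
    using assms unfolding hol_hom_def by blast
  have "cis \<theta> *s z \<in> sphere 0 1" using assms by (simp add: norm_vector_scalar_mult)
  then have "f (cis \<theta> *s z) = (\<Sum>\<alpha> | (\<Sum>i\<in>UNIV. \<alpha> i) = j. c \<alpha> * (\<Prod>i\<in>UNIV. ((cis \<theta> *s z) $ i) ^ \<alpha> i))"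
    by (rule c)
  also have "\<dots> = (\<Sum>\<alpha> | (\<Sum>i\<in>UNIV. \<alpha> i) = j. cis \<theta> ^ j * (c \<alpha> * (\<Prod>i\<in>UNIV. (z $ i) ^ \<alpha> i)))"
  proof (rule sum.cong[OF refl])
    fix \<alpha> :: "'a \<Rightarrow> nat" assume "\<alpha> \<in> {\<alpha>. (\<Sum>i\<in>UNIV. \<alpha> i) = j}"
    then have "(\<Prod>i\<in>UNIV. cis \<theta> ^ \<alpha> i) = cis \<theta> ^ j" by (simp flip: power_sum)
    then show "c \<alpha> * (\<Prod>i\<in>UNIV. ((cis \<theta> *s z) $ i) ^ \<alpha> i) = cis \<theta> ^ j * (c \<alpha> * (\<Prod>i\<in>UNIV. (z $ i) ^ \<alpha> i))"
      by (simp add: power_mult_distrib prod.distrib)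
  qed
  also have "\<dots> = cis \<theta> ^ j * f z" by (simp add: c[OF assms(2)] sum_distrib_left)
  finally show ?thesis by (simp add: Complex.DeMoivre)
qed

text \<open>The increase of \<open>\<Prod>l. 1 + (cmod (a l))^2 / 2\<close> when factor
  \<open>k\<close> is adjoined, that is, the squared mass this factor adds. Its logarithm is the
  numerator in the definition of the exponent.\<close>

definition riesz_increment :: "(nat \<Rightarrow> complex) \<Rightarrow> nat \<Rightarrow> real" where
  "riesz_increment a k = (cmod (a k))\<^sup>2 / 2 * (\<Prod>l\<in>{1..<k}. 1 + (cmod (a l))\<^sup>2 / 2)"

lemma riesz_increment_nonneg: "riesz_increment a k \<ge> 0"
  by (simp add: riesz_increment_def prod_nonneg)

lemma riesz_triple_lacunary:
  assumes "riesz_triple R J a" "k \<ge> 1"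
  shows "J k > 0" "3 * J k \<le> J (Suc k)"
proof -
  from assms show J: "J k > 0" by (simp add: riesz_triple_def)
  have "3 \<le> real (J (Suc k)) / real (J k)" using assms by (simp add: riesz_triple_def)
  then have "real (3 * J k) \<le> real (J (Suc k))" using J by (simp add: field_simps)
  then show "3 * J k \<le> J (Suc k)" by linarith
qed

lemma riesz_triple_geometric:
  assumes "riesz_triple R J a"
  shows "3 ^ k \<le> J (Suc k)"
proof (induction k)
  case 0 then show ?case using riesz_triple_lacunary(1)[OF assms, of 1] by simp
next
  case (Suc k)
  then show ?case using riesz_triple_lacunary(2)[OF assms, of "Suc k"] by simp
qed

lemma riesz_increment_summable:
  assumes triple: "riesz_triple R J a" and e: "\<alpha> + e < 0"
    and ev: "\<forall>\<^sub>F k in sequentially. riesz_increment a k \<le> real (J k) powr \<alpha>"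
  shows "summable (\<lambda>k. riesz_increment a k * real (J k) powr e)"
proof (rule summable_comparison_test_ev)
  define q where "q = 3 powr (\<alpha> + e)"
  have q: "0 < q" "q < 1" using e powr_less_mono[of "\<alpha> + e" 0 3] by (simp_all add: q_def)
  \<comment> \<open>Growth by factors of 3 starts at index 1, so \<open>J k\<close> is at least
    \<open>3 ^ (k - 1)\<close>; \<open>inverse q\<close> makes up for the missing step.\<close>
  show "summable (\<lambda>k. inverse q * q ^ k)" using q by (intro summable_mult summable_geometric) simp
  show "\<forall>\<^sub>F k in sequentially. norm (riesz_increment a k * real (J k) powr e) \<le> inverse q * q ^ k"
    using ev eventually_ge_at_top[of 1]
  proof eventually_elim
    case (elim k)
    then obtain i where i: "k = Suc i" by (cases k) auto
    have "norm (riesz_increment a k * real (J k) powr e) = riesz_increment a k * real (J k) powr e"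
      by (simp add: riesz_increment_nonneg)
    also have "\<dots> \<le> real (J k) powr \<alpha> * real (J k) powr e"
      using elim by (intro mult_right_mono) auto
    also have "\<dots> = real (J k) powr (\<alpha> + e)" by (simp add: powr_add)
    also have "\<dots> \<le> (3 ^ i) powr (\<alpha> + e)"
    proof (rule powr_mono2')
      show "3 ^ i \<le> real (J k)"
        using riesz_triple_geometric[OF triple, of i] unfolding i by (metis of_nat_le_iff of_nat_power of_nat_numeral)
    qed (use e in auto)
    also have "\<dots> = q ^ i" by (simp add: q_def powr_powr mult.commute flip: powr_realpow)
    also have "\<dots> = inverse q * q ^ k" using q by (simp add: i)
    finally show ?case .
  qed
qed

lemma riesz_product_energy_finite:
  fixes R :: "nat \<Rightarrow> complex ^ 'n \<Rightarrow> complex"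
  assumes triple: "riesz_triple R J a" and prod: "is_riesz_product R J a \<mu>"
    and t: "0 < t" "0 < \<alpha>" "t + \<alpha> < 2 * real CARD('n) - 1"
    and ev: "\<forall>\<^sub>F k in sequentially. riesz_increment a k \<le> real (J k) powr \<alpha>"
  shows "energy t \<mu> < \<infinity>"
proof -
  obtain \<delta> where RW: "ryll_wojtaszczyk \<delta> R" using triple unfolding riesz_triple_def by blast
  have hom: "R (J k) \<in> hol_hom (J k)"
    and sup: "esssup sphere_measure (\<lambda>z. ereal (cmod (R (J k) z))) = 1" if "k \<ge> 1" for k
    using RW riesz_triple_lacunary(1)[OF triple that] by (auto simp: ryll_wojtaszczyk_def Suc_le_eq)
  \<comment> \<open>The halving turns \<open>cmod (a k) < 1\<close> into the weight
    \<open>(cmod (a k))^2 / 4\<close>; twice this weight, for \<open>b\<close> and its conjugate, is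
    the \<open>(cmod (a k))^2 / 2\<close> of the theorem.\<close>
  define b where "b k z = a k * R (J k) z / 2" for k z
  define w where "w k = (cmod (a k))\<^sup>2 / 4" for k
  interpret riesz_factors b J w
  proof
    fix k :: nat assume k: "k \<ge> 1"
    show "J k > 0" "3 * J k \<le> J (Suc k)" using riesz_triple_lacunary[OF triple k] .
    show "continuous_on (sphere 0 1) (b k)"
      unfolding b_def by (intro continuous_intros hol_hom_continuous[OF hom[OF k]]) simp
    show "b k (cis \<theta> *s z) = cis (real (J k) * \<theta>) * b k z" if "z \<in> sphere 0 1" for z \<theta>
      unfolding b_def hol_hom_phase[OF hom[OF k] that] by simp
    have "AE z in sphere_measure. ereal (cmod (R (J k) z)) \<le> 1"
      using esssup_AE[of "\<lambda>z. ereal (cmod (R (J k) z))" sphere_measure] unfolding sup[OF k] .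
    then show "AE z in sphere_measure. (cmod (b k z))\<^sup>2 \<le> w k"
    proof eventually_elim
      case (elim z)
      then have "(cmod (R (J k) z))\<^sup>2 \<le> 1" by (simp add: abs_square_le_1)
      then have "(cmod (a k))\<^sup>2 * (cmod (R (J k) z))\<^sup>2 \<le> (cmod (a k))\<^sup>2 * 1"
        by (intro mult_left_mono) auto
      then show ?case by (simp add: b_def w_def norm_mult norm_divide power_mult_distrib power_divide)
    qed
  qed (simp add: w_def)
  let ?e = "t - (2 * real CARD('n) - 1)"
  have eq: "2 * w k * (\<Prod>l\<in>{1..<k}. 1 + 2 * w l) = riesz_increment a k" for k
    by (simp add: w_def riesz_increment_def)
  have summ: "summable (\<lambda>k. riesz_increment a k * real (J k) powr ?e)"
    using t ev by (intro riesz_increment_summable[OF triple]) auto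
  have partial_product: "partial_product N z = riesz_partial_product R J a N z" for N z
    by (simp add: partial_product_def riesz_partial_product_def b_def)
  have \<mu>: "prob_space \<mu>" "sets \<mu> = sets sphere_borel"
    "\<And>f :: complex ^ 'n \<Rightarrow> complex. continuous_on (sphere 0 1) f \<Longrightarrow>
        (\<lambda>N. LINT z|sphere_measure. f z * partial_product N z) \<longlonglongrightarrow> (LINT z|\<mu>. f z)"
    using prod unfolding is_riesz_product_def partial_product by blast+
  show ?thesis
  proof (rule energy_finite[OF t(1) _ _ \<mu>])
    show "t < 2 * real CARD('n) - 1" using t by simp
    fix N
    show "(\<Sum>k=1..N. 2 * w k * (\<Prod>l\<in>{1..<k}. 1 + 2 * w l) * real (J k) powr ?e)
      \<le> (\<Sum>k. riesz_increment a k * real (J k) powr ?e)"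
      unfolding eq by (intro sum_le_suminf summ) (simp_all add: riesz_increment_nonneg)
  qed
qed

section \<open>The exponent and the dimension bounds\<close>

definition alpha_term :: "(nat \<Rightarrow> nat) \<Rightarrow> (nat \<Rightarrow> complex) \<Rightarrow> nat \<Rightarrow> ereal" where
  "alpha_term J a k =
     (elog ((cmod (a k))\<^sup>2 / 2) + ereal (\<Sum>l\<in>{1..<k}. ln (1 + (cmod (a l))\<^sup>2 / 2))) / ereal (ln (real (J k)))"

lemma riesz_alpha0_eq: "riesz_alpha0 J a = max 0 (limsup (alpha_term J a))"
  by (simp add: riesz_alpha0_def alpha_term_def[abs_def])

text \<open>Clear the positive denominator \<open>ln (J k)\<close> and exponentiate. A vanishing
  \<open>a k\<close>, where the logarithm is minus infinity, gives increment 0.\<close>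

lemma alpha_term_less_imp:
  assumes less: "alpha_term J a k < ereal \<alpha>" and J: "J k \<ge> 2"
  shows "riesz_increment a k \<le> real (J k) powr \<alpha>"
proof (cases "a k = 0")
  case False
  have L: "ln (real (J k)) > 0" using J by simp
  have pos: "1 + (cmod (a l))\<^sup>2 / 2 > 0" for l by (simp add: add_pos_nonneg)
  have nz: "1 + (cmod (a l))\<^sup>2 / 2 \<noteq> 0" for l using pos[of l] by simp
  have ak: "(cmod (a k))\<^sup>2 / 2 > 0" using False by simp
  have "(ln ((cmod (a k))\<^sup>2 / 2) + (\<Sum>l\<in>{1..<k}. ln (1 + (cmod (a l))\<^sup>2 / 2))) / ln (real (J k)) < \<alpha>"
    using less ak L by (simp add: alpha_term_def elog_def False)
  then have "ln ((cmod (a k))\<^sup>2 / 2) + (\<Sum>l\<in>{1..<k}. ln (1 + (cmod (a l))\<^sup>2 / 2)) < \<alpha> * ln (real (J k))"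
    using L by (simp add: pos_divide_less_eq)
  moreover have "ln (riesz_increment a k) = ln ((cmod (a k))\<^sup>2 / 2) + (\<Sum>l\<in>{1..<k}. ln (1 + (cmod (a l))\<^sup>2 / 2))"
    unfolding riesz_increment_def ln_mult_pos[OF ak prod_pos[OF pos]]
    by (simp only: ln_prod[OF finite_atLeastLessThan nz])
  ultimately have "ln (riesz_increment a k) < \<alpha> * ln (real (J k))" by simp
  moreover have "riesz_increment a k > 0"
    unfolding riesz_increment_def using ak pos by (intro mult_pos_pos prod_pos) auto
  ultimately have "riesz_increment a k \<le> exp (\<alpha> * ln (real (J k)))"
    by (metis exp_le_cancel_iff exp_ln less_imp_le)
  then show ?thesis using J by (simp add: powr_def)
qed (simp add: riesz_increment_def)

lemma alpha_term_le:
  assumes triple: "riesz_triple R J a" and k: "k \<ge> 2" and s: "(\<Sum>l\<in>{1..<k}. ln (1 + (cmod (a l))\<^sup>2 / 2)) \<le> s"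
  shows "alpha_term J a k \<le> ereal (s / ln (real (J k)))"
proof -
  have "3 ^ (k - 1) \<le> J k" using riesz_triple_geometric[OF triple, of "k - 1"] k by simp
  moreover have "(3 :: nat) ^ 1 \<le> 3 ^ (k - 1)" using k by (intro power_increasing) auto
  ultimately have "J k \<ge> 3" by simp
  then have L: "ln (real (J k)) > 0" by simp
  have "cmod (a k) < 1" using triple k by (simp add: riesz_triple_def)
  then have "(cmod (a k))\<^sup>2 \<le> 1" by (simp add: abs_square_le_1)
  then have z: "ln ((cmod (a k))\<^sup>2 / 2) \<le> 0" if "a k \<noteq> 0" using that by (intro ln_le_zero_iff[THEN iffD2]) auto
  have le: "ln ((cmod (a k))\<^sup>2 / 2) + (\<Sum>l\<in>{1..<k}. ln (1 + (cmod (a l))\<^sup>2 / 2)) \<le> s" if "a k \<noteq> 0"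
    using add_mono[OF z[OF that] s] by simp
  show ?thesis
  proof (cases "a k = 0")
    case False
    with divide_right_mono[OF le[OF False], of "ln (real (J k))"] L show ?thesis
      by (simp add: alpha_term_def elog_def)
  qed (use L in \<open>simp add: alpha_term_def elog_def\<close>)
qed

theorem theorem3p2:
  fixes R :: "nat \<Rightarrow> complex ^ 'n \<Rightarrow> complex"
    and J :: "nat \<Rightarrow> nat"
    and a :: "nat \<Rightarrow> complex"
    and \<mu> :: "(complex ^ 'n) measure"
  assumes "CARD('n) \<ge> 2"
    and "riesz_triple R J a"
    and "is_riesz_product R J a \<mu>"
  shows "energy_dim \<mu> \<ge> ereal (2 * real CARD('n) - 1) - riesz_alpha0 J a \<and>
         energy_dim \<mu> \<ge> ereal (2 * real CARD('n) - 1)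
           - limsup (\<lambda>k. ereal (1 / (2 * ln (real (J k))) * (\<Sum>l\<in>{1..<k}. (cmod (a l))\<^sup>2)))"
proof -
  let ?d = "2 * real CARD('n) - 1"
  have ln_le: "(\<Sum>l\<in>{1..<k}. ln (1 + (cmod (a l))\<^sup>2 / 2)) \<le> (\<Sum>l\<in>{1..<k}. (cmod (a l))\<^sup>2 / 2)" for k
    by (intro sum_mono ln_add_one_self_le_self) simp
  \<comment> \<open>Each summand is at most 1, while \<open>ln (J k) \<ge> k - 1\<close> because
    \<open>J k \<ge> 3 ^ (k - 1)\<close> and \<open>exp 1 \<le> 3\<close>. Thus the exponent is a
    real number at most 1, below \<open>?d\<close>, and positive admissible \<open>t\<close>
    exist.\<close>
  have "limsup (alpha_term J a) \<le> 1"
  proof (rule Limsup_bounded)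
    show "\<forall>\<^sub>F k in sequentially. alpha_term J a k \<le> 1"
      using eventually_ge_at_top[of 2]
    proof eventually_elim
      case (elim k)
      have "(\<Sum>l\<in>{1..<k}. (cmod (a l))\<^sup>2 / 2) \<le> (\<Sum>l\<in>{1..<k}. 1)"
      proof (rule sum_mono)
        fix l assume "l \<in> {1..<k}"
        then have "cmod (a l) < 1" using assms(2) by (simp add: riesz_triple_def)
        then have "(cmod (a l))\<^sup>2 \<le> 1" by (simp add: abs_square_le_1)
        then show "(cmod (a l))\<^sup>2 / 2 \<le> 1" by simp
      qed
      then have "(\<Sum>l\<in>{1..<k}. ln (1 + (cmod (a l))\<^sup>2 / 2)) \<le> real (k - 1)" using ln_le[of k] by simp
      then have le: "alpha_term J a k \<le> ereal (real (k - 1) / ln (real (J k)))"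
        by (rule alpha_term_le[OF assms(2) elim])
      have "3 ^ (k - 1) \<le> J k" using riesz_triple_geometric[OF assms(2), of "k - 1"] elim by simp
      then have J: "real (3 ^ (k - 1)) \<le> real (J k)" by (simp only: of_nat_le_iff)
      have "exp (real (k - 1)) = exp 1 ^ (k - 1)" by (simp flip: exp_of_nat_mult)
      also have "\<dots> \<le> 3 ^ (k - 1)" using exp_le by (intro power_mono) auto
      also have "\<dots> = real (3 ^ (k - 1))" by simp
      also note J
      finally have e: "exp (real (k - 1)) \<le> real (J k)" .
      moreover have "real (J k) > 0" by (rule less_le_trans[OF exp_gt_zero e])
      ultimately have l: "real (k - 1) \<le> ln (real (J k))" by (simp add: ln_ge_iff)
      have "0 < real (k - 1)" using elim by simp
      then have "0 < ln (real (J k))" using l by (rule less_le_trans)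
      with l have "real (k - 1) / ln (real (J k)) \<le> 1" by simp
      with le show ?case by (metis ereal_less_eq(3) one_ereal_def order_trans)
    qed
  qed
  then have \<alpha>0: "0 \<le> riesz_alpha0 J a" "riesz_alpha0 J a \<le> 1" by (simp_all add: riesz_alpha0_eq)
  then obtain A where A: "riesz_alpha0 J a = ereal A" "0 \<le> A" "A \<le> 1"
    by (cases "riesz_alpha0 J a") auto
  have fin: "energy t \<mu> < \<infinity>" if t: "0 < t" "t < ?d - A" for t
  proof -
    \<comment> \<open>The midpoint of \<open>A\<close> and \<open>?d - t\<close>: the room above
      \<open>A\<close> yields the eventual bound on increments, and the room below
      \<open>?d - t\<close> yields geometric decay.\<close>
    define \<alpha> where "\<alpha> = (A + (?d - t)) / 2"
    have \<alpha>: "A < \<alpha>" "t + \<alpha> < ?d" using t by (simp_all add: \<alpha>_def field_simps)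
    have "limsup (alpha_term J a) \<le> ereal A" using A(1) unfolding riesz_alpha0_eq by (metis max.cobounded2)
    also have "\<dots> < ereal \<alpha>" using \<alpha> by simp
    finally have "\<forall>\<^sub>F k in sequentially. alpha_term J a k < ereal \<alpha>" by (rule Limsup_lessD)
    then have "\<forall>\<^sub>F k in sequentially. riesz_increment a k \<le> real (J k) powr \<alpha>"
      using eventually_ge_at_top[of 2]
    proof eventually_elim
      case (elim k)
      have "3 ^ (k - 1) \<le> J k" using riesz_triple_geometric[OF assms(2), of "k - 1"] elim by simp
      moreover have "(3 :: nat) ^ 1 \<le> 3 ^ (k - 1)" using elim by (intro power_increasing) auto
      ultimately show ?case using elim by (intro alpha_term_less_imp) auto
    qed
    then show ?thesis using A \<alpha> t by (intro riesz_product_energy_finite[OF assms(2,3)]) auto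
  qed
  have "ereal (?d - A) \<le> energy_dim \<mu>"
  proof (rule dense_le)
    fix y assume y: "y < ereal (?d - A)"
    have "0 < ?d - A" using A assms(1) by simp
    \<comment> \<open>The supremum in \<open>energy_dim\<close> ranges over positive
      \<open>t\<close> only, so \<open>t\<close> is taken above both \<open>y\<close> and 0.\<close>
    then have "max y 0 < ereal (?d - A)" using y by simp
    then obtain t where t: "max y 0 < ereal t" "ereal t < ereal (?d - A)"
      using ereal_dense2 by blast
    then have "energy t \<mu> < \<infinity>" by (intro fin) auto
    then have "ereal t \<le> energy_dim \<mu>"
      using t unfolding energy_dim_def by (intro Sup_upper imageI) auto
    with t show "y \<le> energy_dim \<mu>" by auto
  qed
  then have 1: "ereal ?d - riesz_alpha0 J a \<le> energy_dim \<mu>" by (simp add: A)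
  \<comment> \<open>The second bound is weaker than the first: \<open>ln (1 + x) \<le> x\<close>
    controls the sum, and the maximum with 0 is absorbed because the new quotients are
    nonnegative.\<close>
  have "riesz_alpha0 J a \<le> limsup (\<lambda>k. ereal (1 / (2 * ln (real (J k))) * (\<Sum>l\<in>{1..<k}. (cmod (a l))\<^sup>2)))"
    unfolding riesz_alpha0_eq
  proof (rule max.boundedI)
    have "0 = limsup (\<lambda>k::nat. 0 :: ereal)" by (simp add: Limsup_const)
    also have "\<dots> \<le> limsup (\<lambda>k. ereal (1 / (2 * ln (real (J k))) * (\<Sum>l\<in>{1..<k}. (cmod (a l))\<^sup>2)))"
    proof (rule Limsup_mono, rule always_eventually, rule allI)
      fix k
      \<comment> \<open>The value \<open>J 0\<close> is arbitrary and may be 0; the default value of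
        \<open>ln\<close> at 0 keeps the inequality valid there as well.\<close>
      have "ln (real (J k)) \<ge> 0" by (cases "J k = 0") auto
      then show "0 \<le> ereal (1 / (2 * ln (real (J k))) * (\<Sum>l\<in>{1..<k}. (cmod (a l))\<^sup>2))"
        by (simp add: sum_nonneg)
    qed
    finally show "0 \<le> limsup (\<lambda>k. ereal (1 / (2 * ln (real (J k))) * (\<Sum>l\<in>{1..<k}. (cmod (a l))\<^sup>2)))" .
    show "limsup (alpha_term J a) \<le> limsup (\<lambda>k. ereal (1 / (2 * ln (real (J k))) * (\<Sum>l\<in>{1..<k}. (cmod (a l))\<^sup>2)))"
    proof (rule Limsup_mono)
      show "\<forall>\<^sub>F k in sequentially. alpha_term J a k \<le> ereal (1 / (2 * ln (real (J k))) * (\<Sum>l\<in>{1..<k}. (cmod (a l))\<^sup>2))"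
        using eventually_ge_at_top[of 2]
      proof eventually_elim
        case (elim k)
        have "alpha_term J a k \<le> ereal ((\<Sum>l\<in>{1..<k}. (cmod (a l))\<^sup>2 / 2) / ln (real (J k)))"
          by (rule alpha_term_le[OF assms(2) elim ln_le])
        also have "(\<Sum>l\<in>{1..<k}. (cmod (a l))\<^sup>2 / 2) / ln (real (J k)) = 1 / (2 * ln (real (J k))) * (\<Sum>l\<in>{1..<k}. (cmod (a l))\<^sup>2)"
          by (simp add: sum_divide_distrib[symmetric])
        finally show ?case .
      qed
    qed
  qed
  then have "ereal ?d - limsup (\<lambda>k. ereal (1 / (2 * ln (real (J k))) * (\<Sum>l\<in>{1..<k}. (cmod (a l))\<^sup>2)))
     \<le> ereal ?d - riesz_alpha0 J a" by (intro ereal_minus_mono) auto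
  with 1 show ?thesis by (auto intro: order_trans)
qed

end
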